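(* For a given $n\times n$ payoff matrix of a turn of an all-pay bidding game, finding an optimal strategy and the corresponding payoff (by the binary-search algorithm described in the context) requires time on the order of $O(\log(n)\,n^2)$.
   Context: All-pay bidding game. The underlying game is a two-player zero-sum game played by moving a token on an acyclic directed graph with two marked vertices $\mathcal{A}$ and $\mathcal{B}$; edges are coloured red or blue, player $A$ may move the token only along red edges and player $B$ only along blue edges. $A$ wins if the token reaches $\mathcal{A}$, $B$ wins if it reaches $\mathcal{B}$, and there are no ties. $\mathcal{S}_A(G)$ (resp. $\mathcal{S}_B(G)$) is the set of positions $A$ (resp. $B$) can move to from position $G$. $G_{a,b}$ denotes a single turn at position $G$ when $A$ holds $a$ chips and $B$ holds $b$ chips: simultaneously $A$ bids $j\in\{0,\dots,a\}$ and $B$ bids $i\in\{0,\dots,b\}$; each pays his bid to the other, so afterwards $A$ has $a-j+i$ and $B$ has $b-i+j$ chips. The higher bidder wins the bid; when bids are equal the bid is won by the player with advantage, who is the player holding more chips before the bid ($A$ if $a=b$). The bid winner decides which player makes the next move. Payoffs. $v_A(G_{a,b})\in[0,1]$ is the probability that $A$ wins under optimal play: it is $1$ at $\mathcal{A}$, $0$ at $\mathcal{B}$, and otherwise is the value of the zero-sum matrix game with the following payoff matrix. The payoff matrix $M_A=M_A(G_{a,b})$, indexed from $0$ with rows for $B$'s bids and columns for $A$'s bids, has as $(i,j)$ entry $A$'s probability of winning after $A$ bids $j$ and $B$ bids $i$: with $p=\max_{G'\in\mathcal{S}_A(G)}v_A(G'_{a-j+i,b-i+j})$ and $q=\min_{G'\in\mathcal{S}_B(G)}v_A(G'_{a-j+i,b-i+j})$,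 the entry is $\max(p,q)$ if $A$ wins the bid and $\min(p,q)$ if $B$ wins the bid. This matrix is Toeplitz (constant along diagonals). Strategies. A strategy is a probability vector whose $i$-th entry (from $0$) is the probability of bidding $i$. If $A$ plays $S_A$ and $B$ plays $S_B$, $A$'s payoff is $S_B^TM_AS_A$ and $B$'s is $1-S_B^TM_AS_A$. An optimal (= Nash equilibrium) strategy is one maximizing the player's minimum payoff. The length of a strategy is one more than the largest bid made with nonzero probability. A turn is precise if in every successor state it is strictly better to have one more chip. Algorithm. Let $A$ be the player with advantage. First assign each chip an arbitrarily small value $x>0$, i.e. add to the $(i,j)$ entry of the payoff matrix $x$ times the number $a-j+i$ of chips $A$ holds after the turn; the adjusted turn is precise. Write $M_A(k)$ for the top-left $k\times k$ submatrix of the resulting payoff matrix and $\mathbf{1}_k$ for the all-ones vector of length $k$. Find the length $\ell$ of $A$'s optimal strategy by binary search on $k$: if $M_A(k)$ is invertible and $M_A(k)^{-1}\mathbf{1}_k$ has all nonnegative entries, continue the search with $k$ as the lower bound, otherwise with $k$ as the upper bound. Then $A$'s optimal strategy is $S_A=M_A(\ell)^{-1}\mathbf{1}_\ell/(\mathbf{1}_\ell^TM_A(\ell)^{-1}\mathbf{1}_\ell)$ (padded with zeros), and an optimal strategy for $B$ is obtained by reversing the order of its first $\ell$ entries. For turns that are not precise, the strategies so obtained approximate optimal strategies of the unadjusted turn to any desired degree of accuracy, by taking $x$ small. The binary search requires $\log(n)$ iterations, each of which solves one Toeplitz system (in $O(n^2)$ time by the Levinson–Trench–Zohar algorithm) and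 scans one vector for negative entries. *)

theory Defs
  imports
    "Jordan_Normal_Form.Matrix"
    "HOL-Library.Landau_Symbols"
    "HOL-Library.Monad_Syntax"
begin

section \<open>Matrix games\<close>

text \<open>Rows are bids of \<open>B\<close>, columns are bids of \<open>A\<close>, entries are payoffs of \<open>A\<close>; the payoff
  of \<open>B\<close> is one minus the payoff of \<open>A\<close>.\<close>

definition strategies :: "nat \<Rightarrow> real vec set" where
  "strategies m = {s \<in> carrier_vec m. (\<forall>i<m. 0 \<le> s $ i) \<and> (\<Sum>i<m. s $ i) = 1}"

definition payoff_A :: "real mat \<Rightarrow> real vec \<Rightarrow> real vec \<Rightarrow> real" where
  "payoff_A M s t = t \<bullet> (M *\<^sub>v s)"

definition payoff_B :: "real mat \<Rightarrow> real vec \<Rightarrow> real vec \<Rightarrow> real" where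
  "payoff_B M s t = 1 - payoff_A M s t"

definition min_payoff_A :: "real mat \<Rightarrow> real vec \<Rightarrow> real" where
  "min_payoff_A M s = (INF t\<in>strategies (dim_row M). payoff_A M s t)"

definition min_payoff_B :: "real mat \<Rightarrow> real vec \<Rightarrow> real" where
  "min_payoff_B M t = (INF s\<in>strategies (dim_col M). payoff_B M s t)"

definition game_value :: "real mat \<Rightarrow> real" where
  "game_value M = (SUP s\<in>strategies (dim_col M). min_payoff_A M s)"

definition optimal_A :: "real mat \<Rightarrow> real vec \<Rightarrow> bool" where
  "optimal_A M s \<longleftrightarrow> s \<in> strategies (dim_col M) \<and>
     (\<forall>s'\<in>strategies (dim_col M). min_payoff_A M s' \<le> min_payoff_A M s)"

definition optimal_B :: "real mat \<Rightarrow> real vec \<Rightarrow> bool" where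
  "optimal_B M t \<longleftrightarrow> t \<in> strategies (dim_row M) \<and>
     (\<forall>t'\<in>strategies (dim_row M). min_payoff_B M t' \<le> min_payoff_B M t)"

definition near_optimal_A :: "real \<Rightarrow> real mat \<Rightarrow> real vec \<Rightarrow> bool" where
  "near_optimal_A e M s \<longleftrightarrow> s \<in> strategies (dim_col M) \<and>
     (\<forall>s'\<in>strategies (dim_col M). min_payoff_A M s' \<le> min_payoff_A M s + e)"

definition near_optimal_B :: "real \<Rightarrow> real mat \<Rightarrow> real vec \<Rightarrow> bool" where
  "near_optimal_B e M t \<longleftrightarrow> t \<in> strategies (dim_row M) \<and>
     (\<forall>t'\<in>strategies (dim_row M). min_payoff_B M t' \<le> min_payoff_B M t + e)"


section \<open>All-pay bidding games\<close>

text \<open>\<open>w G' c d\<close> is the probability that \<open>A\<close> wins from \<open>G'\<close> when \<open>A\<close> has \<open>c\<close> and \<open>B\<close> has \<open>d\<close>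
  chips; \<open>SA\<close> and \<open>SB\<close> are the positions \<open>A\<close> and \<open>B\<close> can move to.  The truncated subtractions
  are exact since \<open>j \<le> a\<close> and \<open>i \<le> b\<close>.\<close>

definition turn_matrix ::
  "'v set \<Rightarrow> 'v set \<Rightarrow> ('v \<Rightarrow> nat \<Rightarrow> nat \<Rightarrow> real) \<Rightarrow> nat \<Rightarrow> nat \<Rightarrow> real mat" where
  "turn_matrix SA SB w a b = mat (Suc b) (Suc a) (\<lambda>(i, j).
     let p = Max ((\<lambda>G'. w G' (a - j + i) (b - i + j)) ` SA);
         q = Min ((\<lambda>G'. w G' (a - j + i) (b - i + j)) ` SB)
     in if i < j \<or> (i = j \<and> b \<le> a) then max p q else min p q)"

lemma turn_matrix_cong [fundef_cong]:
  assumes "SA = SA'" "SB = SB'" "a = a'" "b = b'"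
    and "\<And>G' c d. G' \<in> SA' \<union> SB' \<Longrightarrow> w G' c d = w' G' c d"
  shows "turn_matrix SA SB w a b = turn_matrix SA' SB' w' a' b'"
proof -
  have "(\<lambda>G'. w G' c d) ` SA' = (\<lambda>G'. w' G' c d) ` SA'"
    "(\<lambda>G'. w G' c d) ` SB' = (\<lambda>G'. w' G' c d) ` SB'" for c d
    using assms(5) by (auto intro!: image_cong)
  then show ?thesis
    unfolding turn_matrix_def assms(1-4) by simp
qed

text \<open>The maximum and the minimum in the payoff matrix range over the moves of \<open>A\<close> and of \<open>B\<close>,
  so both players must have a move wherever the game is not over.\<close>

locale bidding_game =
  fixes V :: "'v set" and red blue :: "('v \<times> 'v) set" and goal_A goal_B :: 'v
  assumes finite_V: "finite V"
    and red_edges: "red \<subseteq> V \<times> V"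
    and blue_edges: "blue \<subseteq> V \<times> V"
    and acyclic_edges: "acyclic (red \<union> blue)"
    and goal_A_in: "goal_A \<in> V"
    and goal_B_in: "goal_B \<in> V"
    and goals_distinct: "goal_A \<noteq> goal_B"
    and moves_A: "\<And>G. G \<in> V - {goal_A, goal_B} \<Longrightarrow> red `` {G} \<noteq> {}"
    and moves_B: "\<And>G. G \<in> V - {goal_A, goal_B} \<Longrightarrow> blue `` {G} \<noteq> {}"
begin

lemma wf_moves: "wf ((red \<union> blue)\<inverse>)"
proof (rule finite_acyclic_wf_converse)
  show "finite (red \<union> blue)"
    using finite_V red_edges blue_edges by (meson finite_SigmaI finite_UnI finite_subset)
qed (rule acyclic_edges)

function v_A :: "'v \<Rightarrow> nat \<Rightarrow> nat \<Rightarrow> real" where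
  "v_A G a b =
     (if G = goal_A then 1 else if G = goal_B then 0
      else game_value (turn_matrix (red `` {G}) (blue `` {G}) (\<lambda>G' c d. v_A G' c d) a b))"
  by pat_completeness auto
termination
  by (relation "inv_image ((red \<union> blue)\<inverse>) fst") (auto simp: wf_moves intro: wf_inv_image)

declare v_A.simps [simp del]

definition payoff_matrix :: "'v \<Rightarrow> nat \<Rightarrow> nat \<Rightarrow> real mat" where
  "payoff_matrix G a b = turn_matrix (red `` {G}) (blue `` {G}) v_A a b"

text \<open>The successor states of \<open>G\<close> are those where \<open>A\<close> has \<open>c \<in> {0..a + b}\<close> chips and \<open>B\<close> has
  the rest.  The payoff of \<open>B\<close> is \<open>1 - v_A\<close>, so one condition serves both players.\<close>

definition precise :: "'v \<Rightarrow> nat \<Rightarrow> nat \<Rightarrow> bool" where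
  "precise G a b \<longleftrightarrow> (\<forall>G' \<in> red `` {G} \<union> blue `` {G}. \<forall>c < a + b.
     v_A G' c (a + b - c) < v_A G' (Suc c) (a + b - Suc c))"

end

text \<open>\<open>c\<close> is the number of chips held before the turn by the player who bids on columns.\<close>

definition adjusted_matrix :: "real \<Rightarrow> nat \<Rightarrow> real mat \<Rightarrow> real mat" where
  "adjusted_matrix x c M =
     mat (dim_row M) (dim_col M) (\<lambda>(i, j). M $$ (i, j) + x * real (c - j + i))"

definition swap_players :: "real mat \<Rightarrow> real mat" where
  "swap_players M = mat (dim_col M) (dim_row M) (\<lambda>(i, j). 1 - M $$ (j, i))"

text \<open>The adjusted payoff matrix of the player with advantage, with his bids on the columns.
  Adding \<open>x\<close> per chip to the payoffs of \<open>B\<close> instead of those of \<open>A\<close> changes the zero-sum game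
  by the constant \<open>x * (a + b)\<close> only.\<close>

definition advantaged_matrix :: "real \<Rightarrow> nat \<Rightarrow> nat \<Rightarrow> real mat \<Rightarrow> real mat" where
  "advantaged_matrix x a b M =
     (if b \<le> a then adjusted_matrix x a M else adjusted_matrix x b (swap_players M))"

definition leading_submatrix :: "nat \<Rightarrow> real mat \<Rightarrow> real mat" where
  "leading_submatrix k M = mat k k (\<lambda>(i, j). M $$ (i, j))"

definition inverse_ones_nonneg :: "real mat \<Rightarrow> bool" where
  "inverse_ones_nonneg M \<longleftrightarrow> (\<exists>W \<in> carrier_mat (dim_row M) (dim_row M).
     inverts_mat M W \<and> inverts_mat W M \<and>
     (\<forall>i < dim_row M. 0 \<le> (W *\<^sub>v vec (dim_row M) (\<lambda>_. 1)) $ i))"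


section \<open>Computations with a cost\<close>

text \<open>Unit-cost model: every arithmetic operation, comparison, coercion, matrix access and list
  cell inspected or built is charged at least one.  Only branching on a computed value and naming
  or pairing of values are free; each charged step does a bounded number of these.\<close>

datatype 'a timed = Timed (result: 'a) (cost: nat)

definition tick :: "'a \<Rightarrow> 'a timed" where
  "tick r = Timed r 1"

definition bind_timed :: "'a timed \<Rightarrow> ('a \<Rightarrow> 'b timed) \<Rightarrow> 'b timed" where
  "bind_timed m f = Timed (result (f (result m))) (cost m + cost (f (result m)))"

adhoc_overloading Monad_Syntax.bind \<rightleftharpoons> bind_timed

lemma bind_timed_cong [fundef_cong]:
  assumes "m = m'" "\<And>z. z = result m' \<Longrightarrow> f z = f' z"
  shows "bind_timed m f = bind_timed m' f'"
  using assms by (simp add: bind_timed_def)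

fun take_t :: "nat \<Rightarrow> real list \<Rightarrow> real list timed" where
  "take_t 0 ys = tick []"
| "take_t (Suc k) [] = tick []"
| "take_t (Suc k) (y # ys) = do { zs \<leftarrow> take_t k ys; tick (y # zs) }"

fun snoc_t :: "real list \<Rightarrow> real \<Rightarrow> real list timed" where
  "snoc_t [] z = tick [z]"
| "snoc_t (y # ys) z = do { zs \<leftarrow> snoc_t ys z; tick (y # zs) }"

fun rev_append_t :: "real list \<Rightarrow> real list \<Rightarrow> real list timed" where
  "rev_append_t [] zs = tick zs"
| "rev_append_t (y # ys) zs = do { zs' \<leftarrow> tick (y # zs); rev_append_t ys zs' }"

fun dot_t :: "real list \<Rightarrow> real list \<Rightarrow> real timed" where
  "dot_t (y # ys) (z # zs) = do { r \<leftarrow> dot_t ys zs; p \<leftarrow> tick (y * z); tick (p + r) }"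
| "dot_t ys zs = tick 0"

fun lincomb_t :: "real \<Rightarrow> real list \<Rightarrow> real \<Rightarrow> real list \<Rightarrow> real list timed" where
  "lincomb_t p (y # ys) q (z # zs) = do {
     rest \<leftarrow> lincomb_t p ys q zs;
     py \<leftarrow> tick (p * y);
     qz \<leftarrow> tick (q * z);
     r \<leftarrow> tick (py + qz);
     tick (r # rest) }"
| "lincomb_t p ys q zs = tick []"

fun sum_t :: "real list \<Rightarrow> real timed" where
  "sum_t [] = tick 0"
| "sum_t (y # ys) = do { r \<leftarrow> sum_t ys; tick (y + r) }"

fun divide_t :: "real list \<Rightarrow> real \<Rightarrow> real list timed" where
  "divide_t [] s = tick []"
| "divide_t (y # ys) s = do { zs \<leftarrow> divide_t ys s; z \<leftarrow> tick (y / s); tick (z # zs) }"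

fun all_nonneg_t :: "real list \<Rightarrow> bool timed" where
  "all_nonneg_t [] = tick True"
| "all_nonneg_t (y # ys) = do { p \<leftarrow> tick (0 \<le> y); if p then all_nonneg_t ys else tick False }"

text \<open>The list \<open>[g m, \<dots>, g (m + k - 1)]\<close>.\<close>

fun tabulate_t :: "(nat \<Rightarrow> real timed) \<Rightarrow> nat \<Rightarrow> nat \<Rightarrow> real list timed" where
  "tabulate_t g m 0 = tick []"
| "tabulate_t g m (Suc k) = do {
     y \<leftarrow> g m;
     m' \<leftarrow> tick (Suc m);
     ys \<leftarrow> tabulate_t g m' k;
     tick (y # ys) }"


section \<open>The Levinson--Trench--Zohar algorithm\<close>

text \<open>Let \<open>T\<^sub>k\<close> be the leading \<open>k \<times> k\<close> submatrix of a Toeplitz matrix with first column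
  \<open>c\<^sub>0, c\<^sub>1, \<dots>\<close> and first row \<open>c\<^sub>0, r\<^sub>1, r\<^sub>2, \<dots>\<close>.  The invariant of \<open>levinson_t\<close> is
  \<open>past = [c\<^bsub>k-1\<^esub>, \<dots>, c\<^sub>1]\<close>, \<open>hs = [r\<^sub>1, r\<^sub>2, \<dots>]\<close>, \<open>T\<^sub>k u = e\<^sub>1\<close>, \<open>T\<^sub>k w = e\<^sub>k\<close> and \<open>T\<^sub>k y = 1\<^sub>k\<close>;
  each step extends \<open>u\<close>, \<open>w\<close> and \<open>y\<close> to \<open>T\<^bsub>k+1\<^esub>\<close> in linear time.  \<open>None\<close> is returned as soon as
  some \<open>T\<^sub>k\<close> is singular.\<close>

fun levinson_t :: "real list \<Rightarrow> real list \<Rightarrow> real list \<Rightarrow> real list \<Rightarrow> real list \<Rightarrow> real list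
    \<Rightarrow> real list option timed" where
  "levinson_t [] past hs u w y = tick (Some y)"
| "levinson_t (c # cs) past hs u w y = do {
     past' \<leftarrow> tick (c # past);
     eu \<leftarrow> dot_t past' u;
     ew \<leftarrow> dot_t hs w;
     ey \<leftarrow> dot_t past' y;
     prd \<leftarrow> tick (eu * ew);
     d \<leftarrow> tick (1 - prd);
     singular \<leftarrow> tick (d = 0);
     if singular then tick None
     else do {
       u0 \<leftarrow> snoc_t u 0;
       w0 \<leftarrow> tick (0 # w);
       y0 \<leftarrow> snoc_t y 0;
       p \<leftarrow> tick (1 / d);
       nu \<leftarrow> tick (- eu);
       qu \<leftarrow> tick (nu / d);
       nw \<leftarrow> tick (- ew);
       qw \<leftarrow> tick (nw / d);
       qy \<leftarrow> tick (1 - ey);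
       u' \<leftarrow> lincomb_t p u0 qu w0;
       w' \<leftarrow> lincomb_t p w0 qw u0;
       y' \<leftarrow> lincomb_t 1 y0 qy w';
       levinson_t cs past' hs u' w' y' } }"

text \<open>Solves \<open>T y = 1\<close> for the Toeplitz matrix \<open>T\<close> with the given first column; \<open>hs\<close> is the
  first row and may be longer than needed.\<close>

fun toeplitz_solve_t :: "real list \<Rightarrow> real list \<Rightarrow> real list option timed" where
  "toeplitz_solve_t (c # cs) (r # hs) = do {
     singular \<leftarrow> tick (c = 0);
     if singular then tick None
     else do { p \<leftarrow> tick (1 / c); levinson_t cs [] hs [p] [p] [p] } }"
| "toeplitz_solve_t _ _ = tick None"


section \<open>The binary search\<close>

text \<open>\<open>vs\<close> and \<open>hs\<close> are the first column and the first row of the adjusted matrix.  A singular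
  smaller leading submatrix also makes the test fail; for the adjusted matrices of turns the test
  is nevertheless equivalent to invertibility of the \<open>k \<times> k\<close> submatrix together with
  nonnegativity, which is part of the claim.\<close>

definition length_test_t :: "real list \<Rightarrow> real list \<Rightarrow> nat \<Rightarrow> bool timed" where
  "length_test_t vs hs k = do {
     vs' \<leftarrow> take_t k vs;
     sol \<leftarrow> toeplitz_solve_t vs' hs;
     case sol of None \<Rightarrow> tick False | Some y \<Rightarrow> all_nonneg_t y }"

function search_t :: "real list \<Rightarrow> real list \<Rightarrow> nat \<Rightarrow> nat \<Rightarrow> nat timed" where
  "search_t vs hs lo hi = do {
     lo' \<leftarrow> tick (Suc lo);
     stop \<leftarrow> tick (hi \<le> lo');
     if stop then tick lo
     else do {
       s \<leftarrow> tick (lo + hi);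
       k \<leftarrow> tick (s div 2);
       ok \<leftarrow> length_test_t vs hs k;
       if ok then search_t vs hs k hi else search_t vs hs lo k } }"
  by pat_completeness auto
termination
  by (relation "Wellfounded.measure (\<lambda>(vs, hs, lo, hi). hi - lo)")
    (auto simp: tick_def)

declare search_t.simps [simp del]

text \<open>Entry \<open>(i, j)\<close> of \<open>advantaged_matrix x a b M\<close>.\<close>

definition adjusted_entry_t :: "real \<Rightarrow> nat \<Rightarrow> nat \<Rightarrow> real mat \<Rightarrow> nat \<Rightarrow> nat \<Rightarrow> real timed" where
  "adjusted_entry_t x a b M i j = do {
     adv_A \<leftarrow> tick (b \<le> a);
     m \<leftarrow> (if adv_A then tick (M $$ (i, j))
           else do { m' \<leftarrow> tick (M $$ (j, i)); tick (1 - m') });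
     own \<leftarrow> tick (if adv_A then a else b);
     c \<leftarrow> tick (own - j);
     c' \<leftarrow> tick (c + i);
     z \<leftarrow> tick (real c');
     z' \<leftarrow> tick (x * z);
     tick (m + z') }"

definition diagonals_t ::
  "real \<Rightarrow> nat \<Rightarrow> nat \<Rightarrow> real mat \<Rightarrow> nat \<Rightarrow> (real list \<times> real list) timed" where
  "diagonals_t x a b M n = do {
     vs \<leftarrow> tabulate_t (\<lambda>i. adjusted_entry_t x a b M i 0) 0 n;
     hs \<leftarrow> tabulate_t (\<lambda>j. adjusted_entry_t x a b M 0 j) 0 n;
     tick (vs, hs) }"

text \<open>The search keeps the length in \<open>{lo..<hi}\<close>.  Length one is treated separately because
  normalizing divides by zero if the matrix is zero, as can happen when nobody holds a chip.\<close>

definition advantaged_strategy_t :: "real list \<Rightarrow> real list \<Rightarrow> nat \<Rightarrow> real list timed" where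
  "advantaged_strategy_t vs hs n = do {
     hi \<leftarrow> tick (Suc n);
     l \<leftarrow> search_t vs hs 1 hi;
     single \<leftarrow> tick (l = 1);
     if single then tick [1]
     else do {
       vs' \<leftarrow> take_t l vs;
       sol \<leftarrow> toeplitz_solve_t vs' hs;
       case sol of None \<Rightarrow> tick []
       | Some y \<Rightarrow> do { s \<leftarrow> sum_t y; divide_t y s } } }"

fun row_payoff_t :: "real mat \<Rightarrow> nat \<Rightarrow> nat \<Rightarrow> real list \<Rightarrow> real timed" where
  "row_payoff_t M i j [] = tick 0"
| "row_payoff_t M i j (s # ss) = do {
     m \<leftarrow> tick (M $$ (i, j));
     p \<leftarrow> tick (m * s);
     j' \<leftarrow> tick (Suc j);
     r \<leftarrow> row_payoff_t M i j' ss;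
     tick (p + r) }"

fun payoff_t :: "real mat \<Rightarrow> nat \<Rightarrow> real list \<Rightarrow> real list \<Rightarrow> real timed" where
  "payoff_t M i ss [] = tick 0"
| "payoff_t M i ss (t # ts) = do {
     q \<leftarrow> row_payoff_t M i 0 ss;
     p \<leftarrow> tick (t * q);
     i' \<leftarrow> tick (Suc i);
     r \<leftarrow> payoff_t M i' ss ts;
     tick (p + r) }"

text \<open>\<open>M\<close> is the payoff matrix of \<open>A\<close> at a turn where \<open>A\<close> has \<open>a\<close> and \<open>B\<close> has \<open>b\<close> chips.  Only
  its leading \<open>n \<times> n\<close> part with \<open>n = min a b + 1\<close> is read: the player with advantage already wins
  the bid by matching the largest bid of the opponent.  The result consists of a strategy of \<open>A\<close>,
  a strategy of \<open>B\<close> (both without trailing zeros for bids that are never considered) and the payoff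
  of \<open>A\<close> when these are played in the turn given by \<open>M\<close>.\<close>

definition solve_turn_t ::
  "real \<Rightarrow> nat \<Rightarrow> nat \<Rightarrow> real mat \<Rightarrow> (real list \<times> real list \<times> real) timed" where
  "solve_turn_t x a b M = do {
     adv_A \<leftarrow> tick (b \<le> a);
     m \<leftarrow> tick (if adv_A then b else a);
     n \<leftarrow> tick (Suc m);
     (vs, hs) \<leftarrow> diagonals_t x a b M n;
     adv \<leftarrow> advantaged_strategy_t vs hs n;
     opp \<leftarrow> rev_append_t adv [];
     (ss, ts) \<leftarrow> tick (if adv_A then (adv, opp) else (opp, adv));
     v \<leftarrow> payoff_t M 0 ss ts;
     tick (ss, ts, v) }"

definition pad :: "nat \<Rightarrow> real list \<Rightarrow> real vec" where
  "pad m ys = vec m (\<lambda>i. if i < length ys then ys ! i else 0)"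

definition strategy_A :: "real \<Rightarrow> nat \<Rightarrow> nat \<Rightarrow> real mat \<Rightarrow> real vec" where
  "strategy_A x a b M = pad (Suc a) (fst (result (solve_turn_t x a b M)))"

definition strategy_B :: "real \<Rightarrow> nat \<Rightarrow> nat \<Rightarrow> real mat \<Rightarrow> real vec" where
  "strategy_B x a b M = pad (Suc b) (fst (snd (result (solve_turn_t x a b M))))"

definition computed_payoff :: "real \<Rightarrow> nat \<Rightarrow> nat \<Rightarrow> real mat \<Rightarrow> real" where
  "computed_payoff x a b M = snd (snd (result (solve_turn_t x a b M)))"

definition length_test :: "real \<Rightarrow> nat \<Rightarrow> nat \<Rightarrow> real mat \<Rightarrow> nat \<Rightarrow> bool" where
  "length_test x a b M k = (case result (diagonals_t x a b M (Suc (min a b))) of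
     (vs, hs) \<Rightarrow> result (length_test_t vs hs k))"

end

theory Submission
  imports Defs "Jordan_Normal_Form.Determinant" "HOL-Real_Asymp.Real_Asymp"
begin

text \<open>For the player with advantage the adjusted turn is a Toeplitz matrix \<open>t (i - j)\<close> with \<open>t\<close>
  strictly increasing on the nonpositive and on the positive indices, because chips are worth having:
  a strategy for \<open>(a, b)\<close> remains available, and does no worse, with chips \<open>(a + 1, b - 1)\<close>.
  If \<open>y\<close> is nonnegative, consecutive rows \<open>i\<close>, \<open>i + 1\<close> of \<open>T y\<close> are strictly increasing whenever
  \<open>y i = 0\<close>.  Hence a nonnegative solution of \<open>T\<^sub>k y = 1\<close> has no gaps, and the boundary of the
  orthant cannot be reached along a kernel vector, so \<open>T\<^sub>k\<close> is invertible.  If the next row pays at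
  most one, weight moves to the next bid until the solution extends to \<open>T\<^bsub>k+1\<^esub>\<close>; if it pays more
  than one, no longer nonnegative solution exists.  So the solvable lengths form an initial segment,
  all leading minors needed by the Levinson recursion are nonzero there, and at the maximal length
  the solution and its reversal form a saddle point.\<close>

section \<open>Matrix games and monotonicity in chips\<close>

text \<open>The right-hand side one is a normalization: if \<open>y\<close> is nonnegative,
  \<open>T\<^sub>k y = 1\<close> and \<open>S\<close> is its total weight, then \<open>y\<close>
  divided by \<open>S\<close> is a strategy against which each of the first \<open>k\<close>
  opposing bids pays exactly \<open>1 / S\<close>. Its reversal equalizes columns instead, because a
  Toeplitz matrix turns into its transpose when the order of both indices is reversed. The obstacle
  is the diagonal. Payoffs grow with the chips held after the turn, except possibly from index 0 to
  index 1, where a won tie becomes a lost bid. Two consecutive rows meet this step in a single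
  column, so growth of the rows can fail only through the weight there; hence the attention to
  vanishing coordinates. The theory of lengths rests on strict growth of \<open>t\<close> on either
  side of this step, on nonnegativity, and on a positive diagonal when the opponent has a chip. A
  precise turn with \<open>x = 0\<close> and any turn with \<open>x > 0\<close> provide these
  equally. The original game is reached through a saddle point with slack, since adjusting moves an
  entry by at most \<open>x * (a + b)\<close>.\<close>

lemma payoff_A_sum:
  assumes "s \<in> carrier_vec (dim_col M)" "t \<in> carrier_vec (dim_row M)"
  shows "payoff_A M s t = (\<Sum>i<dim_row M. t $ i * (\<Sum>j<dim_col M. M $$ (i, j) * s $ j))"
  using assms by (auto simp: payoff_A_def scalar_prod_def atLeast0LessThan intro!: sum.cong)

lemma payoff_A_sum_columns:
  assumes "s \<in> carrier_vec (dim_col M)" "t \<in> carrier_vec (dim_row M)"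
  shows "payoff_A M s t = (\<Sum>j<dim_col M. s $ j * (\<Sum>i<dim_row M. t $ i * M $$ (i, j)))"
  unfolding payoff_A_sum[OF assms] sum_distrib_left
  by (subst sum.swap) (simp add: mult_ac)

lemma strategies_carrier: "s \<in> strategies m \<Longrightarrow> s \<in> carrier_vec m"
  by (simp add: strategies_def)

lemma strategies_nonempty:
  assumes "0 < m" shows "strategies m \<noteq> {}"
proof -
  have "vec m (\<lambda>i. if i = 0 then 1 else 0) \<in> strategies m"
    using assms by (auto simp: strategies_def sum.delta)
  then show ?thesis by blast
qed

lemma convex_combination_ge:
  assumes "s \<in> strategies m" "\<And>i. i < m \<Longrightarrow> v \<le> f i"
  shows "v \<le> (\<Sum>i<m. s $ i * f i)"
proof -
  have "v = (\<Sum>i<m. s $ i * v)"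
    using assms(1) by (simp add: strategies_def flip: sum_distrib_right)
  also have "\<dots> \<le> (\<Sum>i<m. s $ i * f i)"
    using assms by (intro sum_mono mult_left_mono) (auto simp: strategies_def)
  finally show ?thesis .
qed

lemma convex_combination_le:
  assumes "s \<in> strategies m" "\<And>i. i < m \<Longrightarrow> f i \<le> v"
  shows "(\<Sum>i<m. s $ i * f i) \<le> v"
  using convex_combination_ge[of s m "- v" "\<lambda>i. - f i"] assms by (simp add: sum_negf)

text \<open>\<open>INF\<close> and \<open>SUP\<close> over the reals are meaningful for bounded sets
  only. This crude bound is independent of both strategies and so serves both players.\<close>

lemma abs_payoff_A_le:
  assumes s: "s \<in> strategies (dim_col M)" and t: "t \<in> strategies (dim_row M)"
  shows "\<bar>payoff_A M s t\<bar> \<le> (\<Sum>i<dim_row M. \<Sum>j<dim_col M. \<bar>M $$ (i, j)\<bar>)"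
proof -
  have inner: "\<bar>\<Sum>j<dim_col M. s $ j * M $$ (i, j)\<bar> \<le> (\<Sum>j<dim_col M. \<bar>M $$ (i, j)\<bar>)" for i
  proof -
    have "- (\<Sum>j<dim_col M. \<bar>M $$ (i, j)\<bar>) \<le> M $$ (i, k)
        \<and> M $$ (i, k) \<le> (\<Sum>j<dim_col M. \<bar>M $$ (i, j)\<bar>)"
      if "k < dim_col M" for k
      using member_le_sum[of k "{..<dim_col M}" "\<lambda>j. \<bar>M $$ (i, j)\<bar>"] that by auto
    then show ?thesis
      using convex_combination_le[OF s] convex_combination_ge[OF s] by (simp add: abs_le_iff minus_le_iff)
  qed
  have "\<bar>\<Sum>j<dim_col M. M $$ (i, j) * s $ j\<bar> \<le> (\<Sum>i<dim_row M. \<Sum>j<dim_col M. \<bar>M $$ (i, j)\<bar>)"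
    if "i < dim_row M" for i
    using inner[of i] that
      member_le_sum[of i "{..<dim_row M}" "\<lambda>i. \<Sum>j<dim_col M. \<bar>M $$ (i, j)\<bar>"]
    by (simp add: sum_nonneg mult.commute)
  then show ?thesis
    unfolding payoff_A_sum[OF strategies_carrier[OF s] strategies_carrier[OF t]]
    by (simp add: abs_le_iff minus_le_iff convex_combination_le[OF t] convex_combination_ge[OF t])
qed

lemma min_payoff_A_le:
  assumes "s \<in> strategies (dim_col M)" "t \<in> strategies (dim_row M)"
  shows "min_payoff_A M s \<le> payoff_A M s t"
  unfolding min_payoff_A_def
proof (rule cINF_lower)
  show "bdd_below (payoff_A M s ` strategies (dim_row M))"
    using abs_payoff_A_le[OF assms(1)]
    by (intro bdd_belowI2[where m = "- (\<Sum>i<dim_row M. \<Sum>j<dim_col M. \<bar>M $$ (i, j)\<bar>)"])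
      (force simp: abs_le_iff)
qed (rule assms)

lemma min_payoff_B_le:
  assumes "s \<in> strategies (dim_col M)" "t \<in> strategies (dim_row M)"
  shows "min_payoff_B M t \<le> payoff_B M s t"
  unfolding min_payoff_B_def
proof (rule cINF_lower)
  show "bdd_below ((\<lambda>s. payoff_B M s t) ` strategies (dim_col M))"
    using abs_payoff_A_le[OF _ assms(2)]
    by (intro bdd_belowI2[where m = "1 - (\<Sum>i<dim_row M. \<Sum>j<dim_col M. \<bar>M $$ (i, j)\<bar>)"])
      (force simp: abs_le_iff payoff_B_def)
qed (rule assms)

lemma min_payoff_A_le_game_value:
  assumes "s \<in> strategies (dim_col M)" "0 < dim_row M"
  shows "min_payoff_A M s \<le> game_value M"
  unfolding game_value_def
proof (rule cSUP_upper)
  obtain t where t: "t \<in> strategies (dim_row M)"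
    using strategies_nonempty[OF assms(2)] by blast
  show "bdd_above (min_payoff_A M ` strategies (dim_col M))"
  proof (rule bdd_aboveI2)
    fix s assume s: "s \<in> strategies (dim_col M)"
    show "min_payoff_A M s \<le> (\<Sum>i<dim_row M. \<Sum>j<dim_col M. \<bar>M $$ (i, j)\<bar>)"
      using min_payoff_A_le[OF s t] abs_payoff_A_le[OF s t] by linarith
  qed
qed (rule assms)

text \<open>A pair of strategies certifies the value by itself: \<open>s\<close> guarantees
  \<open>v - e\<close> and \<open>t\<close> concedes at most \<open>v + e\<close>, which leaves a
  margin of \<open>2 * e\<close> for improvements. Used with \<open>e = 0\<close> for the adjusted
  game and with the size of the perturbation for the original one.\<close>

lemma approximate_saddle_point:
  assumes s: "s \<in> strategies (dim_col M)" and t: "t \<in> strategies (dim_row M)"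
    and dims: "0 < dim_row M" "0 < dim_col M"
    and rows: "\<And>i. i < dim_row M \<Longrightarrow> v - e \<le> (\<Sum>j<dim_col M. M $$ (i, j) * s $ j)"
    and cols: "\<And>j. j < dim_col M \<Longrightarrow> (\<Sum>i<dim_row M. t $ i * M $$ (i, j)) \<le> v + e"
  shows "near_optimal_A (2 * e) M s" "near_optimal_B (2 * e) M t"
    "\<bar>game_value M - v\<bar> \<le> e" "\<bar>payoff_A M s t - v\<bar> \<le> e"
proof -
  have lower: "v - e \<le> payoff_A M s t'" if "t' \<in> strategies (dim_row M)" for t'
    using that s by (simp add: payoff_A_sum strategies_carrier convex_combination_ge rows)
  have upper: "payoff_A M s' t \<le> v + e" if "s' \<in> strategies (dim_col M)" for s'
    using that t by (simp add: payoff_A_sum_columns strategies_carrier convex_combination_le cols)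
  have A_lower: "v - e \<le> min_payoff_A M s"
    unfolding min_payoff_A_def
    by (rule cINF_greatest) (auto simp: strategies_nonempty dims lower)
  have A_upper: "min_payoff_A M s' \<le> v + e" if "s' \<in> strategies (dim_col M)" for s'
    using min_payoff_A_le[OF that t] upper[OF that] by linarith
  have B_lower: "1 - (v + e) \<le> min_payoff_B M t"
    unfolding min_payoff_B_def payoff_B_def
    by (rule cINF_greatest) (auto simp: strategies_nonempty dims upper diff_left_mono)
  have B_upper: "min_payoff_B M t' \<le> 1 - (v - e)" if "t' \<in> strategies (dim_row M)" for t'
    using min_payoff_B_le[OF s that] lower[OF that] by (simp add: payoff_B_def)
  show "near_optimal_A (2 * e) M s"
    using s A_lower A_upper by (fastforce simp: near_optimal_A_def)
  show "near_optimal_B (2 * e) M t"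
    using t B_lower B_upper by (fastforce simp: near_optimal_B_def)
  have "game_value M \<le> v + e"
    unfolding game_value_def
    by (rule cSUP_least) (auto simp: strategies_nonempty dims A_upper)
  moreover have "v - e \<le> game_value M"
    using A_lower min_payoff_A_le_game_value[OF s dims(1)] by linarith
  ultimately show "\<bar>game_value M - v\<bar> \<le> e" by linarith
  show "\<bar>payoff_A M s t - v\<bar> \<le> e"
    using lower[OF t] upper[OF s] by linarith
qed

lemma near_optimal_zero:
  "near_optimal_A 0 = optimal_A" "near_optimal_B 0 = optimal_B"
  by (auto simp: near_optimal_A_def optimal_A_def near_optimal_B_def optimal_B_def fun_eq_iff)

section \<open>Comparing games of different sizes\<close>

definition extend_vec :: "nat \<Rightarrow> real vec \<Rightarrow> real vec" where
  "extend_vec m s = vec m (\<lambda>i. if i < dim_vec s then s $ i else 0)"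

lemma sum_extend_vec:
  assumes "dim_vec s = k" "k \<le> m"
  shows "(\<Sum>i<m. extend_vec m s $ i * f i) = (\<Sum>i<k. s $ i * f i)"
proof -
  have "(\<Sum>i<k. s $ i * f i) = (\<Sum>i<k. extend_vec m s $ i * f i)"
    using assms by (intro sum.cong) (auto simp: extend_vec_def)
  also have "\<dots> = (\<Sum>i<m. extend_vec m s $ i * f i)"
    using assms by (intro sum.mono_neutral_left) (auto simp: extend_vec_def)
  finally show ?thesis by simp
qed

lemma extend_vec_strategies:
  assumes "s \<in> strategies k" "k \<le> m"
  shows "extend_vec m s \<in> strategies m"
  using assms sum_extend_vec[of s k m "\<lambda>_. 1"] by (auto simp: strategies_def extend_vec_def)

text \<open>Extra columns are extra bids of \<open>A\<close>, missing rows are missing bids of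
  \<open>B\<close>. Padding with zeros carries a strategy of \<open>A\<close> from \<open>M\<close>
  to \<open>N\<close> and one of \<open>B\<close> from \<open>N\<close> to \<open>M\<close>, so only
  the common block of entries matters.\<close>

lemma game_value_mono:
  assumes dims: "0 < dim_row N" "dim_row N \<le> dim_row M" "0 < dim_col M" "dim_col M \<le> dim_col N"
    and le: "\<And>i j. i < dim_row N \<Longrightarrow> j < dim_col M \<Longrightarrow> M $$ (i, j) \<le> N $$ (i, j)"
  shows "game_value M \<le> game_value N"
proof -
  have "min_payoff_A M s \<le> game_value N" if s: "s \<in> strategies (dim_col M)" for s
  proof -
    let ?s = "extend_vec (dim_col N) s"
    have s': "?s \<in> strategies (dim_col N)"
      using extend_vec_strategies[OF s] dims by simp
    have ds: "dim_vec s = dim_col M"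
      using s by (auto simp: strategies_def)
    have "min_payoff_A M s \<le> payoff_A N ?s t" if t: "t \<in> strategies (dim_row N)" for t
    proof -
      let ?t = "extend_vec (dim_row M) t"
      have t': "?t \<in> strategies (dim_row M)"
        using extend_vec_strategies[OF t] dims by simp
      have dt: "dim_vec t = dim_row N"
        using t by (auto simp: strategies_def)
      have "min_payoff_A M s \<le> payoff_A M s ?t"
        by (rule min_payoff_A_le[OF s t'])
      also have "\<dots> = (\<Sum>i<dim_row N. t $ i * (\<Sum>j<dim_col M. s $ j * M $$ (i, j)))"
        using s t' dims dt by (simp add: payoff_A_sum strategies_carrier sum_extend_vec mult.commute[of "M $$ _"])
      also have "\<dots> \<le> (\<Sum>i<dim_row N. t $ i * (\<Sum>j<dim_col M. s $ j * N $$ (i, j)))"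
        using s t by (intro sum_mono mult_left_mono le) (auto simp: strategies_def)
      also have "\<dots> = payoff_A N ?s t"
        using s' t dims ds by (simp add: payoff_A_sum strategies_carrier sum_extend_vec mult.commute[of "N $$ _"])
      finally show ?thesis .
    qed
    then have "min_payoff_A M s \<le> min_payoff_A N ?s"
      unfolding min_payoff_A_def[of N] by (intro cINF_greatest) (auto simp: strategies_nonempty dims)
    also have "\<dots> \<le> game_value N"
      by (rule min_payoff_A_le_game_value[OF s' dims(1)])
    finally show ?thesis .
  qed
  then show ?thesis
    unfolding game_value_def[of M] by (intro cSUP_least) (auto simp: strategies_nonempty dims)
qed

lemma game_value_constant:
  assumes "0 < m" "0 < n"
  shows "game_value (mat m n (\<lambda>_. v)) = v"
proof -
  obtain s t where s: "s \<in> strategies n" and t: "t \<in> strategies m"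
    using strategies_nonempty assms by blast
  have "\<bar>game_value (mat m n (\<lambda>_. v)) - v\<bar> \<le> 0"
    using s t assms
    by (intro approximate_saddle_point(3)[of s _ t])
      (auto simp: strategies_def simp flip: sum_distrib_left sum_distrib_right)
  then show ?thesis by simp
qed

section \<open>Payoff matrices of turns and values of positions\<close>

lemma dim_turn_matrix [simp]:
  "dim_row (turn_matrix SA SB w a b) = Suc b" "dim_col (turn_matrix SA SB w a b) = Suc a"
  by (simp_all add: turn_matrix_def)

lemma turn_matrix_entry:
  assumes "i \<le> b" "j \<le> a"
  shows "turn_matrix SA SB w a b $$ (i, j) =
     (let p = Max ((\<lambda>G'. w G' (a - j + i) (b - i + j)) ` SA);
          q = Min ((\<lambda>G'. w G' (a - j + i) (b - i + j)) ` SB)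
      in if i < j \<or> (i = j \<and> b \<le> a) then max p q else min p q)"
  using assms by (simp add: turn_matrix_def)

lemma Max_image_mono:
  fixes f g :: "'v \<Rightarrow> real"
  assumes "finite S" "S \<noteq> {}" "\<And>x. x \<in> S \<Longrightarrow> f x \<le> g x"
  shows "Max (f ` S) \<le> Max (g ` S)"
proof -
  have "Max (f ` S) \<in> f ` S"
    by (rule Max_in) (use assms in auto)
  then obtain z where "z \<in> S" "Max (f ` S) = f z"
    by blast
  moreover from this have "g z \<le> Max (g ` S)"
    using assms(1) by simp
  ultimately show ?thesis
    using assms(3)[of z] by simp
qed

lemma Min_image_mono:
  fixes f g :: "'v \<Rightarrow> real"
  assumes "finite S" "S \<noteq> {}" "\<And>x. x \<in> S \<Longrightarrow> f x \<le> g x"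
  shows "Min (f ` S) \<le> Min (g ` S)"
proof -
  have "Min (g ` S) \<in> g ` S"
    by (rule Min_in) (use assms in auto)
  then obtain z where "z \<in> S" "Min (g ` S) = g z"
    by blast
  moreover from this have "Min (f ` S) \<le> f z"
    using assms(1) by simp
  ultimately show ?thesis
    using assms(3)[of z] by simp
qed

lemma Max_image_strict_mono:
  fixes f g :: "'v \<Rightarrow> real"
  assumes "finite S" "S \<noteq> {}" "\<And>x. x \<in> S \<Longrightarrow> f x < g x"
  shows "Max (f ` S) < Max (g ` S)"
proof -
  have "Max (f ` S) \<in> f ` S"
    by (rule Max_in) (use assms in auto)
  then obtain z where "z \<in> S" "Max (f ` S) = f z"
    by blast
  moreover from this have "g z \<le> Max (g ` S)"
    using assms(1) by simp
  ultimately show ?thesis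
    using assms(3)[of z] by simp
qed

lemma Min_image_strict_mono:
  fixes f g :: "'v \<Rightarrow> real"
  assumes "finite S" "S \<noteq> {}" "\<And>x. x \<in> S \<Longrightarrow> f x < g x"
  shows "Min (f ` S) < Min (g ` S)"
proof -
  have "Min (g ` S) \<in> g ` S"
    by (rule Min_in) (use assms in auto)
  then obtain z where "z \<in> S" "Min (g ` S) = g z"
    by blast
  moreover from this have "Min (f ` S) \<le> f z"
    using assms(1) by simp
  ultimately show ?thesis
    using assms(3)[of z] by simp
qed

lemma Max_image_bounds:
  fixes f :: "'v \<Rightarrow> real"
  assumes "finite S" "S \<noteq> {}" "\<And>x. x \<in> S \<Longrightarrow> l \<le> f x \<and> f x \<le> u"
  shows "l \<le> Max (f ` S) \<and> Max (f ` S) \<le> u"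
  using assms by (auto simp: Max_le_iff Max_ge_iff)

lemma Min_image_bounds:
  fixes f :: "'v \<Rightarrow> real"
  assumes "finite S" "S \<noteq> {}" "\<And>x. x \<in> S \<Longrightarrow> l \<le> f x \<and> f x \<le> u"
  shows "l \<le> Min (f ` S) \<and> Min (f ` S) \<le> u"
  using assms by (auto simp: Min_ge_iff Min_le_iff)

lemma turn_matrix_bounds:
  assumes fin: "finite SA" "SA \<noteq> {}" "finite SB" "SB \<noteq> {}"
    and w: "\<And>G' c d. G' \<in> SA \<union> SB \<Longrightarrow> 0 \<le> w G' c d \<and> w G' c d \<le> 1"
    and ij: "i \<le> b" "j \<le> a"
  shows "0 \<le> turn_matrix SA SB w a b $$ (i, j) \<and> turn_matrix SA SB w a b $$ (i, j) \<le> 1"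
proof -
  let ?f = "\<lambda>G'. w G' (a - j + i) (b - i + j)"
  have "0 \<le> Max (?f ` SA) \<and> Max (?f ` SA) \<le> 1" "0 \<le> Min (?f ` SB) \<and> Min (?f ` SB) \<le> 1"
    using fin w by (intro Max_image_bounds Min_image_bounds; blast)+
  moreover have "0 \<le> (if X then max p q else min p q) \<and> (if X then max p q else min p q) \<le> 1"
    if "0 \<le> p \<and> p \<le> 1" "0 \<le> q \<and> q \<le> 1" for p q :: real and X
    using that by (auto simp: max_def min_def)
  ultimately show ?thesis
    unfolding turn_matrix_entry[OF ij] Let_def by blast
qed

text \<open>Under equal bids the extra chip stays with \<open>A\<close>, whoever wins. Advantage can
  only move towards \<open>A\<close>, since \<open>Suc b \<le> a\<close> implies
  \<open>b \<le> Suc a\<close>, and winning a tie replaces a minimum by a maximum.\<close>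

lemma turn_matrix_extra_chip:
  assumes fin: "finite SA" "SA \<noteq> {}" "finite SB" "SB \<noteq> {}"
    and w: "\<And>G' c d. G' \<in> SA \<union> SB \<Longrightarrow> w G' c (Suc d) \<le> w G' (Suc c) d"
    and ij: "i \<le> b" "j \<le> a"
  shows "turn_matrix SA SB w a (Suc b) $$ (i, j) \<le> turn_matrix SA SB w (Suc a) b $$ (i, j)"
proof -
  let ?f = "\<lambda>G'. w G' (a - j + i) (Suc b - i + j)"
  let ?g = "\<lambda>G'. w G' (Suc a - j + i) (b - i + j)"
  have "?f G' \<le> ?g G'" if "G' \<in> SA \<union> SB" for G'
    using w[OF that, of "a - j + i" "b - i + j"] ij by (simp add: Suc_diff_le)
  then have "Max (?f ` SA) \<le> Max (?g ` SA)" "Min (?f ` SB) \<le> Min (?g ` SB)"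
    using fin by (intro Max_image_mono Min_image_mono; blast)+
  then show ?thesis
    using ij unfolding Let_def
    by (subst (1 2) turn_matrix_entry) (auto simp: Let_def max_def min_def)
qed

context bidding_game
begin

lemma moves_finite: "finite (red `` {G})" "finite (blue `` {G})"
  using finite_V red_edges blue_edges by (auto intro!: finite_subset[of _ V])

lemma moves_in: "G' \<in> red `` {G} \<union> blue `` {G} \<Longrightarrow> G' \<in> V"
  using red_edges blue_edges by auto

lemma v_A_bounds: "G \<in> V \<Longrightarrow> 0 \<le> v_A G a b \<and> v_A G a b \<le> 1"
proof (induction G arbitrary: a b rule: wf_induct_rule[OF wf_moves])
  case (1 G)
  show ?case
  proof (cases "G = goal_A \<or> G = goal_B")
    case True
    then show ?thesis by (auto simp: v_A.simps)
  next
    case False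
    then have G: "G \<in> V - {goal_A, goal_B}" using 1 by blast
    let ?M = "turn_matrix (red `` {G}) (blue `` {G}) v_A a b"
    have entry: "0 \<le> ?M $$ (i, j) \<and> ?M $$ (i, j) \<le> 1" if "i \<le> b" "j \<le> a" for i j
      using 1 moves_in moves_A[OF G] moves_B[OF G] moves_finite that
      by (intro turn_matrix_bounds) auto
    have "game_value (mat (Suc b) (Suc a) (\<lambda>_. 0)) \<le> game_value ?M"
      "game_value ?M \<le> game_value (mat (Suc b) (Suc a) (\<lambda>_. 1))"
      using entry by (auto intro!: game_value_mono)
    then show ?thesis
      using False by (subst (1 2) v_A.simps) (simp add: game_value_constant)
  qed
qed

lemma v_A_extra_chip: "G \<in> V \<Longrightarrow> v_A G a (Suc b) \<le> v_A G (Suc a) b"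
proof (induction G arbitrary: a b rule: wf_induct_rule[OF wf_moves])
  case (1 G)
  show ?case
  proof (cases "G = goal_A \<or> G = goal_B")
    case True
    then show ?thesis by (auto simp: v_A.simps)
  next
    case False
    then have G: "G \<in> V - {goal_A, goal_B}" using 1 by blast
    let ?M = "turn_matrix (red `` {G}) (blue `` {G}) v_A"
    \<comment> \<open>The matrices differ in shape: the poorer \<open>A\<close> faces one more row
      and has one column less. Both changes have the direction required by
      \<open>game_value_mono\<close>.\<close>
    have "?M a (Suc b) $$ (i, j) \<le> ?M (Suc a) b $$ (i, j)" if "i \<le> b" "j \<le> a" for i j
      using 1 moves_in moves_A[OF G] moves_B[OF G] moves_finite that
      by (intro turn_matrix_extra_chip) auto
    then have "game_value (?M a (Suc b)) \<le> game_value (?M (Suc a) b)"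
      by (intro game_value_mono) auto
    then show ?thesis
      using False by (subst (1 2) v_A.simps) simp
  qed
qed

end

section \<open>Toeplitz games\<close>

text \<open>The row index is an integer: negative rows of the same extension express payoffs of
  columns against reversed weights, and row \<open>- 1\<close> occurs in the Levinson
  recursion.\<close>

definition toeplitz_row :: "(int \<Rightarrow> real) \<Rightarrow> nat \<Rightarrow> (nat \<Rightarrow> real) \<Rightarrow> int \<Rightarrow> real" where
  "toeplitz_row t k y i = (\<Sum>j<k. t (i - int j) * y j)"

definition toeplitz_nonsingular :: "(int \<Rightarrow> real) \<Rightarrow> nat \<Rightarrow> bool" where
  "toeplitz_nonsingular t k \<longleftrightarrow>
     (\<forall>z. (\<forall>i<k. toeplitz_row t k z (int i) = 0) \<longrightarrow> (\<forall>j<k. z j = 0))"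

definition solves_ones :: "(int \<Rightarrow> real) \<Rightarrow> nat \<Rightarrow> (nat \<Rightarrow> real) \<Rightarrow> bool" where
  "solves_ones t k y \<longleftrightarrow> (\<forall>j<k. 0 \<le> y j) \<and> (\<forall>i<k. toeplitz_row t k y (int i) = 1)"

lemma toeplitz_row_linear:
  "toeplitz_row t k (\<lambda>j. p * y j + q * z j) i = p * toeplitz_row t k y i + q * toeplitz_row t k z i"
  by (simp add: toeplitz_row_def sum.distrib sum_distrib_left algebra_simps)

lemma toeplitz_row_Suc:
  "toeplitz_row t (Suc k) y i = toeplitz_row t k y i + t (i - int k) * y k"
  by (simp add: toeplitz_row_def)

lemma toeplitz_row_cong:
  "(\<And>j. j < k \<Longrightarrow> y j = z j) \<Longrightarrow> toeplitz_row t k y i = toeplitz_row t k z i"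
  by (simp add: toeplitz_row_def)

lemma toeplitz_row_nonzero:
  assumes "\<And>j. j < k \<Longrightarrow> 0 \<le> y j" "toeplitz_row t k y i \<noteq> 0"
  shows "\<exists>j<k. 0 < y j"
proof (rule ccontr)
  assume "\<not> ?thesis"
  then have "y j = 0" if "j < k" for j
    using assms(1)[OF that] that by (meson order_antisym_conv not_less)
  then show False
    using assms(2) by (simp add: toeplitz_row_def)
qed

text \<open>Double summation in a matrix that reversal transposes: the entry
  \<open>t (h - i - j)\<close> is symmetric in \<open>i\<close> and \<open>j\<close>.\<close>

lemma toeplitz_row_swap:
  "(\<Sum>i<k. z i * toeplitz_row t l y (h - int i)) = (\<Sum>j<l. y j * toeplitz_row t k z (h - int j))"
  unfolding toeplitz_row_def sum_distrib_left
  by (subst sum.swap) (simp add: algebra_simps)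

lemma toeplitz_nonsingularD:
  assumes "toeplitz_nonsingular t k"
    and "\<And>i. i < k \<Longrightarrow> toeplitz_row t k y (int i) = toeplitz_row t k z (int i)"
    and "j < k"
  shows "y j = z j"
proof -
  have "toeplitz_row t k (\<lambda>j. 1 * y j + (- 1) * z j) (int i) = 0" if "i < k" for i
    using assms(2)[OF that] unfolding toeplitz_row_linear by simp
  then have "1 * y j + (- 1) * z j = 0"
    using assms(1,3) unfolding toeplitz_nonsingular_def by (elim allE impE) auto
  then show ?thesis by simp
qed

text \<open>The ratio test of the simplex method: among the decreasing coordinates, the least
  quotient \<open>\<alpha> i / - \<beta> i\<close> is the first time at which one of them reaches
  zero.\<close>

lemma affine_first_zero:
  fixes \<alpha> \<beta> :: "'i \<Rightarrow> real"
  assumes "finite I" and pos: "\<And>i. i \<in> I \<Longrightarrow> 0 < \<alpha> i" and neg: "i0 \<in> I" "\<beta> i0 < 0"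
  shows "\<exists>\<epsilon>>0. (\<exists>i\<in>I. \<alpha> i + \<epsilon> * \<beta> i = 0) \<and> (\<forall>j\<in>I. 0 \<le> \<alpha> j + \<epsilon> * \<beta> j)"
proof -
  define J where "J = {i \<in> I. \<beta> i < 0}"
  define r where "r i = \<alpha> i / - \<beta> i" for i
  have J: "finite J" "J \<noteq> {}"
    using assms by (auto simp: J_def)
  have "Min (r ` J) \<in> r ` J"
    by (rule Min_in) (use J in auto)
  then obtain i where i: "i \<in> J" "Min (r ` J) = r i"
    by blast
  have least: "r i \<le> r j" if "j \<in> J" for j
    using that J i(2) Min_le[of "r ` J" "r j"] by auto
  have "0 < r i" "i \<in> I" "\<alpha> i + r i * \<beta> i = 0"
    using i(1) pos[of i] by (auto simp: J_def r_def divide_simps)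
  moreover have "0 \<le> \<alpha> j + r i * \<beta> j" if "j \<in> I" for j
  proof (cases "\<beta> j < 0")
    case True
    then have "r i \<le> \<alpha> j / - \<beta> j"
      using least[of j] that by (simp add: J_def r_def)
    then show ?thesis
      using True pos_le_divide_eq[of "- \<beta> j" "r i" "\<alpha> j"] by simp
  next
    case False
    then show ?thesis
      using pos[OF that] \<open>0 < r i\<close> by simp
  qed
  ultimately show ?thesis by blast
qed

text \<open>\<open>t (i - j)\<close> is the payoff when the column player, who wins ties, bids \<open>j < c\<close> and the row
  player bids \<open>i < m\<close>.  The payoff may drop between \<open>0\<close> and \<open>1\<close>, where the bid changes hands.\<close>

locale toeplitz_game =
  fixes t :: "int \<Rightarrow> real" and m c :: nat
  assumes size: "1 \<le> m" "m \<le> c"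
    and incr_neg: "\<And>k. - int c < k \<Longrightarrow> k < 0 \<Longrightarrow> t k < t (k + 1)"
    and incr_pos: "\<And>k. 1 \<le> k \<Longrightarrow> k + 1 < int m \<Longrightarrow> t k < t (k + 1)"
    and nonneg: "\<And>k. - int c < k \<Longrightarrow> k < int m \<Longrightarrow> 0 \<le> t k"
    and diagonal_pos: "1 < m \<Longrightarrow> 0 < t 0"
begin

text \<open>The only step over the drop in row \<open>i\<close> is at column \<open>i\<close>, which carries no weight.\<close>

lemma row_less_next:
  assumes "\<And>j. j < k \<Longrightarrow> 0 \<le> y j" and pos: "j0 < k" "0 < y j0"
    and gap: "\<And>j. j < k \<Longrightarrow> int j = i \<Longrightarrow> y j = 0"
    and range: "int k \<le> int c + i" "i + 1 < int m"
  shows "toeplitz_row t k y i < toeplitz_row t k y (i + 1)"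
  unfolding toeplitz_row_def
proof (rule sum_strict_mono_ex1)
  \<comment> \<open>\<open>range\<close> keeps both indices strictly between \<open>- c\<close> and
    \<open>m\<close>. The row \<open>i\<close> itself may be negative, which is the case needed for
    columns.\<close>
  have less: "t (i - int j) < t (i + 1 - int j)" if "j < k" "int j \<noteq> i" for j
    using incr_neg[of "i - int j"] incr_pos[of "i - int j"] that range
    by (cases "i - int j < 0") (auto simp: algebra_simps)
  show "\<forall>j\<in>{..<k}. t (i - int j) * y j \<le> t (i + 1 - int j) * y j"
    using less gap assms(1) by (metis less_imp_le mult_right_mono lessThan_iff mult_zero_right order_refl)
  have "int j0 \<noteq> i" using gap pos by force
  then show "\<exists>j\<in>{..<k}. t (i - int j) * y j < t (i + 1 - int j) * y j"
    using less pos by (auto intro!: bexI[of _ j0])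
qed simp

text \<open>Nonnegative terms off the diagonal are dropped. It follows that a nonnegative direction
  raises some row, so moving along a kernel vector must make a coordinate decrease.\<close>

lemma diagonal_le_row:
  assumes "\<And>j. j < k \<Longrightarrow> 0 \<le> y j" "i < k" "k \<le> m"
  shows "t 0 * y i \<le> toeplitz_row t k y (int i)"
proof -
  have "t (int i - int i) * y i \<le> toeplitz_row t k y (int i)"
    unfolding toeplitz_row_def using assms size
    by (intro member_le_sum[of i "{..<k}" "\<lambda>j. t (int i - int j) * y j"])
      (auto intro!: mult_nonneg_nonneg nonneg)
  then show ?thesis by simp
qed

lemma solves_ones_some_pos:
  assumes "solves_ones t k y" "1 \<le> k"
  shows "\<exists>j<k. 0 < y j"
proof (rule toeplitz_row_nonzero)
  have "toeplitz_row t k y (int 0) = 1"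
    using assms by (auto simp: solves_ones_def simp del: of_nat_0)
  then show "toeplitz_row t k y (int 0) \<noteq> 0" by simp
qed (use assms in \<open>simp add: solves_ones_def\<close>)

text \<open>For \<open>m = 1\<close> the locale leaves \<open>t 0 = 0\<close> possible; there the
  single equation \<open>t 0 * y 0 = 1\<close> decides.\<close>

lemma solves_ones_diagonal_pos:
  assumes "solves_ones t k y" "1 \<le> k" "k \<le> m"
  shows "0 < t 0"
proof (cases "1 < m")
  case False
  then have k: "k = 1" using assms by simp
  have "toeplitz_row t 1 y (int 0) = 1"
    using assms(1) unfolding k solves_ones_def by blast
  then have "t 0 * y 0 = 1"
    by (simp add: toeplitz_row_def)
  moreover have "0 \<le> t 0"
    using nonneg[of 0] size by simp
  ultimately show ?thesis
    by (metis less_eq_real_def mult_zero_left zero_neq_one)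
qed (rule diagonal_pos)

text \<open>A zero at \<open>j\<close> would make row \<open>j + 1\<close> pay strictly more than
  row \<open>j\<close>, but both pay one. The last coordinate has no following equation and may
  vanish, hence \<open>j + 1 < k\<close>.\<close>

lemma solves_ones_no_gap:
  assumes "solves_ones t k y" "k \<le> m" "j + 1 < k"
  shows "0 < y j"
proof (rule ccontr)
  assume "\<not> 0 < y j"
  then have y: "y j = 0"
    using assms by (auto simp: solves_ones_def intro: order_antisym)
  obtain j0 where "j0 < k" "0 < y j0"
    using solves_ones_some_pos[OF assms(1)] assms by auto
  then have "toeplitz_row t k y (int j) < toeplitz_row t k y (int j + 1)"
    using assms size y by (intro row_less_next[of k y j0]) (auto simp: solves_ones_def)
  moreover have "toeplitz_row t k y (int j) = 1" "toeplitz_row t k y (int (j + 1)) = 1"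
    using assms by (auto simp only: solves_ones_def)
  ultimately show False
    by (simp add: algebra_simps)
qed

text \<open>Following a kernel vector from a nonnegative solution to the boundary of the orthant would
  produce a solution with a gap.\<close>

lemma solves_ones_nonsingular:
  assumes y: "solves_ones t k y" and k: "1 \<le> k" "k \<le> m"
  shows "toeplitz_nonsingular t k"
  unfolding toeplitz_nonsingular_def
proof (rule ccontr)
  assume "\<not> (\<forall>z. (\<forall>i<k. toeplitz_row t k z (int i) = 0) \<longrightarrow> (\<forall>j<k. z j = 0))"
  then obtain z' j' where z': "\<And>i. i < k \<Longrightarrow> toeplitz_row t k z' (int i) = 0" "j' < k" "z' j' \<noteq> 0"
    by blast
  \<comment> \<open>The sign is chosen so that the last coordinate, where \<open>y\<close> may be
    zero, cannot decrease. The coordinates before it start positive.\<close>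
  define z where "z j = (if 0 \<le> z' (k - 1) then z' j else - z' j)" for j
  have zeq: "z = (\<lambda>j. (if 0 \<le> z' (k - 1) then 1 else - 1) * z' j + 0 * z' j)"
    by (auto simp: z_def)
  have ker: "toeplitz_row t k z (int i) = 0" if "i < k" for i
    unfolding zeq toeplitz_row_linear using z'(1)[OF that] by simp
  have last: "0 \<le> z (k - 1)" and nz: "z j' \<noteq> 0"
    using z'(3) by (auto simp: z_def)
  have "\<exists>i0<k. z i0 < 0"
  proof (rule ccontr)
    assume "\<not> ?thesis"
    then have z0: "0 \<le> z j" if "j < k" for j
      using that not_less by blast
    have "t 0 * z j' \<le> 0"
      using diagonal_le_row[of k z j'] z0 z'(2) k ker by auto
    then show False
      using solves_ones_diagonal_pos[OF y k] z0[OF z'(2)] nz by (simp add: mult_le_0_iff)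
  qed
  then obtain i0 where i0: "i0 < k" "z i0 < 0" by blast
  have "i0 \<noteq> k - 1" using last i0 by force
  then have "i0 \<in> {..<k - 1}" using i0 by auto
  moreover have "0 < y j" if "j \<in> {..<k - 1}" for j
    using solves_ones_no_gap[OF y k(2)] that by auto
  ultimately obtain \<epsilon> i where e: "0 < \<epsilon>" "i \<in> {..<k - 1}" "y i + \<epsilon> * z i = 0"
    "\<And>j. j \<in> {..<k - 1} \<Longrightarrow> 0 \<le> y j + \<epsilon> * z j"
    using affine_first_zero[of "{..<k - 1}" y i0 z, OF finite_lessThan _ _ i0(2)] by blast
  \<comment> \<open>The rows do not change along a kernel vector, so the boundary point is again a
    solution, now with a gap at \<open>i < k - 1\<close>.\<close>
  have "solves_ones t k (\<lambda>j. 1 * y j + \<epsilon> * z j)"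
    unfolding solves_ones_def toeplitz_row_linear
  proof (intro conjI allI impI)
    fix j assume "j < k"
    then consider "j \<in> {..<k - 1}" | "j = k - 1" by fastforce
    then show "0 \<le> 1 * y j + \<epsilon> * z j"
    proof cases
      case 2
      then show ?thesis
        using y k last e(1) by (auto simp: solves_ones_def)
    qed (use e(4) in simp)
  qed (use y ker in \<open>auto simp: solves_ones_def\<close>)
  then show False
    using solves_ones_no_gap[of k _ i] k e(2,3) by fastforce
qed

end

lemma toeplitz_mult_vec:
  assumes "v \<in> carrier_vec k" "i < k"
  shows "(mat k k (\<lambda>(i, j). t (int i - int j)) *\<^sub>v v) $ i = toeplitz_row t k (\<lambda>j. v $ j) (int i)"
  using assms by (auto simp: scalar_prod_def toeplitz_row_def atLeast0LessThan intro!: sum.cong)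

lemma toeplitz_nonsingular_inverse:
  assumes "toeplitz_nonsingular t k"
  obtains W where "W \<in> carrier_mat k k" "inverts_mat (mat k k (\<lambda>(i, j). t (int i - int j))) W"
    "inverts_mat W (mat k k (\<lambda>(i, j). t (int i - int j)))"
proof -
  let ?T = "mat k k (\<lambda>(i, j). t (int i - int j))"
  have "v = 0\<^sub>v k" if v: "v \<in> carrier_vec k" "?T *\<^sub>v v = 0\<^sub>v k" for v
  proof (rule eq_vecI)
    fix i assume "i < dim_vec (0\<^sub>v k :: real vec)"
    moreover have "toeplitz_row t k (\<lambda>j. v $ j) (int i) = 0" if "i < k" for i
      using toeplitz_mult_vec[OF v(1) that, of t] v(2) that by simp
    ultimately show "v $ i = 0\<^sub>v k $ i"
      using assms by (simp add: toeplitz_nonsingular_def)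
  qed (use v in auto)
  then have "det ?T \<noteq> 0"
    using det_0_iff_vec_prod_zero_field[of ?T k] by auto
  moreover have "(1 / d) \<cdot>\<^sub>m (d \<cdot>\<^sub>m (1\<^sub>m k)) = 1\<^sub>m k" if "d \<noteq> 0" for d :: real
    using that by (auto intro!: eq_matI)
  ultimately show ?thesis
    using adj_mat[of ?T k]
    by (intro that[of "(1 / det ?T) \<cdot>\<^sub>m adj_mat ?T"])
      (simp_all add: inverts_mat_def mult_smult_distrib[of _ k k _ k] mult_smult_assoc_mat[of _ k k _ k])
qed

lemma toeplitz_nonsingular_solvable:
  assumes "toeplitz_nonsingular t k"
  obtains z where "\<And>i. i < k \<Longrightarrow> toeplitz_row t k z (int i) = f i"
proof -
  let ?T = "mat k k (\<lambda>(i, j). t (int i - int j))"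
  obtain W where W: "W \<in> carrier_mat k k" "inverts_mat ?T W"
    using toeplitz_nonsingular_inverse[OF assms] by blast
  have "toeplitz_row t k (\<lambda>j. (W *\<^sub>v vec k f) $ j) (int i) = f i" if "i < k" for i
  proof -
    have "?T *\<^sub>v (W *\<^sub>v vec k f) = vec k f"
      using W by (simp flip: assoc_mult_mat_vec[of _ k k _ k] add: inverts_mat_def)
    then have "(?T *\<^sub>v (W *\<^sub>v vec k f)) $ i = f i"
      using that by simp
    then show ?thesis
      using that W by (simp add: scalar_prod_def toeplitz_row_def atLeast0LessThan)
  qed
  then show ?thesis by (rule that)
qed

section \<open>Lengthening solutions and the two halves of the saddle point\<close>

context toeplitz_game
begin

text \<open>As long as the next row pays less than one, weight can be moved to the next bid while the
  first \<open>l\<close> rows keep paying one; no coordinate vanishes before row \<open>l\<close> pays one as well.\<close>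

lemma solves_ones_extend:
  assumes y: "solves_ones t l y" and l: "1 \<le> l" "l < m" and le: "toeplitz_row t l y (int l) \<le> 1"
  shows "\<exists>y'. solves_ones t (Suc l) y'"
proof (cases "toeplitz_row t l y (int l) = 1")
  case True
  define y' where "y' j = (if j < l then y j else 0)" for j
  have "toeplitz_row t (Suc l) y' i = toeplitz_row t l y i" for i
    using toeplitz_row_cong[of l y' y t i] by (simp add: toeplitz_row_Suc y'_def)
  then have "solves_ones t (Suc l) y'"
    using y True by (auto simp: solves_ones_def y'_def less_Suc_eq)
  then show ?thesis by blast
next
  case False
  then have less: "toeplitz_row t l y (int l) < 1" using le by simp
  have y0: "0 \<le> y j" if "j < l" for j
    using y that by (auto simp: solves_ones_def)
  have y1: "toeplitz_row t l y (int i) = 1" if "i < l" for i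
    using y that by (auto simp: solves_ones_def)
  obtain z0 where z0: "\<And>i. i < l \<Longrightarrow> toeplitz_row t l z0 (int i) = - t (int i - int l)"
    using toeplitz_nonsingular_solvable[OF solves_ones_nonsingular[OF y l(1)],
        of "\<lambda>i. - t (int i - int l)"] l by auto
  \<comment> \<open>\<open>z0\<close> cancels column \<open>l\<close> in the first \<open>l\<close>
    rows. Moving along \<open>z\<close> thus puts weight on bid \<open>l\<close>, keeps these rows
    at one and changes row \<open>l\<close> at rate \<open>\<rho>\<close>.\<close>
  define z where "z j = (if j < l then z0 j else 1)" for j
  define x where "x j = (if j < l then y j else 0)" for j
  have xz_row: "toeplitz_row t (Suc l) x i = toeplitz_row t l y i"
    "toeplitz_row t (Suc l) z i = toeplitz_row t l z0 i + t (i - int l)" for i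
    using toeplitz_row_cong[of l x y t i] toeplitz_row_cong[of l z z0 t i]
    by (simp_all add: toeplitz_row_Suc x_def z_def)
  define \<rho> where "\<rho> = toeplitz_row t (Suc l) z (int l)"
  have mix: "toeplitz_row t (Suc l) (\<lambda>j. 1 * x j + \<epsilon> * z j) (int i) =
      (if i < l then 1 else toeplitz_row t l y (int l) + \<epsilon> * \<rho>)" if "i \<le> l" for \<epsilon> i
  proof (cases "i < l")
    case True
    have "toeplitz_row t (Suc l) x (int i) = 1" "toeplitz_row t (Suc l) z (int i) = 0"
      by (simp_all only: xz_row z0[OF True] y1[OF True])
    then show ?thesis
      unfolding toeplitz_row_linear using True by simp
  next
    case False
    then have "i = l" using that by simp
    then show ?thesis
      unfolding toeplitz_row_linear \<rho>_def by (simp add: xz_row(1))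
  qed
  \<comment> \<open>With \<open>v j = 0\<close>, row \<open>j + 1\<close> would exceed row
    \<open>j\<close>, which is one; but row \<open>j + 1\<close> is one as well, or it is row
    \<open>l\<close>, which is at most one.\<close>
  have gap: False if mass: "0 \<le> \<epsilon>" "\<And>j. j < l \<Longrightarrow> 0 \<le> y j + \<epsilon> * z j" "j < l" "y j + \<epsilon> * z j = 0"
    "toeplitz_row t l y (int l) + \<epsilon> * \<rho> \<le> 1" for j \<epsilon>
  proof -
    define v where "v j = 1 * x j + \<epsilon> * z j" for j
    have v0: "0 \<le> v j" if "j < Suc l" for j
      using mass(1,2) that by (cases "j < l") (auto simp: v_def x_def z_def)
    have vj: "v j = 0"
      using mass(3,4) by (simp add: v_def x_def)
    have v_row: "toeplitz_row t (Suc l) v (int i) =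
        (if i < l then 1 else toeplitz_row t l y (int l) + \<epsilon> * \<rho>)" if "i \<le> l" for i
      unfolding v_def by (rule mix[OF that])
    have "toeplitz_row t (Suc l) v (int 0) \<noteq> 0"
      using v_row[of 0] l(1) by simp
    then obtain j0 where j0: "j0 < Suc l" "0 < v j0"
      using toeplitz_row_nonzero[of "Suc l" v t "int 0"] v0 by blast
    have "toeplitz_row t (Suc l) v (int j) < toeplitz_row t (Suc l) v (int j + 1)"
      by (rule row_less_next[where k = "Suc l" and y = v, OF v0 j0]) (use vj mass(3) l size in simp_all)
    then have "toeplitz_row t (Suc l) v (int j) < toeplitz_row t (Suc l) v (int (Suc j))"
      by (simp add: add.commute)
    then show False
      using v_row[of j] v_row[of "Suc j"] mass(3,5) by (cases "Suc j < l") simp_all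
  qed
  \<comment> \<open>The ratio test runs over the coordinates and the slack of row \<open>l\<close>
    together; index \<open>l\<close> stands for the slack.\<close>
  define \<alpha> where "\<alpha> i = (if i < l then y i else 1 - toeplitz_row t l y (int l))" for i
  define \<beta> where "\<beta> i = (if i < l then z i else - \<rho>)" for i
  have \<alpha>_pos: "0 < \<alpha> i" if "i \<in> {..l}" for i
  proof (cases "i < l")
    case True
    \<comment> \<open>The start \<open>\<epsilon> = 0\<close> is covered by \<open>gap\<close> too.
      Since row \<open>l\<close> pays less than one, even the last coordinate, left open by
      \<open>solves_ones_no_gap\<close>, is positive.\<close>
    have "y i \<noteq> 0"
    proof
      assume "y i = 0"
      then show False
        using y0 less True by (intro gap[of 0 i]) simp_all
    qed
    then show ?thesis
      using y0[OF True] True by (simp add: \<alpha>_def)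
  next
    case False
    then show ?thesis
      using less by (simp add: \<alpha>_def)
  qed
  \<comment> \<open>If nothing decreased, \<open>z\<close> would be nonnegative with last entry one,
    so row \<open>l\<close> would grow at rate at least \<open>t 0 > 0\<close> and its slack would
    shrink after all.\<close>
  have "\<exists>i0\<le>l. \<beta> i0 < 0"
  proof (rule ccontr)
    assume "\<not> ?thesis"
    then have \<beta>0: "0 \<le> \<beta> i" if "i \<le> l" for i
      using that not_less by blast
    have "0 \<le> z j" if "j < Suc l" for j
      using \<beta>0[of j] that by (cases "j < l") (simp_all add: \<beta>_def z_def)
    then have "t 0 * z l \<le> \<rho>"
      unfolding \<rho>_def by (rule diagonal_le_row) (use l in simp_all)
    moreover have "0 < t 0"
      using diagonal_pos l by simp
    ultimately show False
      using \<beta>0[of l] by (simp add: z_def \<beta>_def)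
  qed
  then obtain i0 where i0: "i0 \<in> {..l}" "\<beta> i0 < 0" by auto
  obtain \<epsilon> i where e: "0 < \<epsilon>" "i \<in> {..l}" "\<alpha> i + \<epsilon> * \<beta> i = 0" "\<And>j. j \<in> {..l} \<Longrightarrow> 0 \<le> \<alpha> j + \<epsilon> * \<beta> j"
    using affine_first_zero[of "{..l}" \<alpha> i0 \<beta>, OF finite_atMost _ i0] \<alpha>_pos by blast
  have nn: "0 \<le> y j + \<epsilon> * z j" if "j < l" for j
    using e(4)[of j] that by (simp add: \<alpha>_def \<beta>_def)
  have row_le: "toeplitz_row t l y (int l) + \<epsilon> * \<rho> \<le> 1"
    using e(4)[of l] by (simp add: \<alpha>_def \<beta>_def)
  have "i = l"
  proof (rule ccontr)
    assume "i \<noteq> l"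
    then have "i < l" using e(2) by simp
    then show False
      using gap[of \<epsilon> i] e(1,3) nn row_le by (simp add: \<alpha>_def \<beta>_def)
  qed
  then have "toeplitz_row t l y (int l) + \<epsilon> * \<rho> = 1"
    using e(3) by (simp add: \<alpha>_def \<beta>_def)
  then have "solves_ones t (Suc l) (\<lambda>j. 1 * x j + \<epsilon> * z j)"
    unfolding solves_ones_def
  proof (intro conjI allI impI)
    fix j assume "j < Suc l"
    then show "0 \<le> 1 * x j + \<epsilon> * z j"
      using nn e(1) by (cases "j < l") (simp_all add: x_def z_def)
  next
    fix i assume "i < Suc l"
    then show "toeplitz_row t (Suc l) (\<lambda>j. 1 * x j + \<epsilon> * z j) (int i) = 1"
      using mix[of i \<epsilon>] \<open>toeplitz_row t l y (int l) + \<epsilon> * \<rho> = 1\<close> by simp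
  qed
  then show ?thesis by blast
qed

text \<open>From row \<open>l\<close> on, the column at which the payoff may drop lies outside the
  support of \<open>z\<close>, so the rows keep increasing.\<close>

lemma solves_ones_rows_beyond:
  assumes z: "solves_ones t l z" and l: "1 \<le> l" and above: "1 < toeplitz_row t l z (int l)"
    and i: "l \<le> i" "i < m"
  shows "1 < toeplitz_row t l z (int i)"
  using i
proof (induction i rule: dec_induct)
  case base
  then show ?case using above by simp
next
  case (step n)
  obtain j0 where "j0 < l" "0 < z j0"
    using solves_ones_some_pos[OF z l] by auto
  then have "toeplitz_row t l z (int n) < toeplitz_row t l z (int n + 1)"
    using z step.hyps step.prems size by (intro row_less_next[of l z j0]) (auto simp: solves_ones_def)
  then show ?case
    using step by (simp add: add.commute)
qed

text \<open>By the Toeplitz symmetry, the payoff of column \<open>j\<close> against the reversed weights \<open>y\<close> is row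
  \<open>l - 1 - j\<close> of \<open>y\<close>.\<close>

lemma solves_ones_columns:
  assumes y: "solves_ones t l y" and l: "1 \<le> l" "l \<le> m" and j: "j < c"
  shows "toeplitz_row t l y (int l - 1 - int j) \<le> 1"
proof (cases "j < l")
  case True
  then have "int l - 1 - int j = int (l - 1 - j)" using l by simp
  then show ?thesis
    using y True l by (simp only: solves_ones_def)
next
  case False
  \<comment> \<open>The induction starts at the last column of the support, which corresponds to row
    0. Later columns correspond to negative rows, which never meet the drop.\<close>
  have "l - 1 \<le> j" using False by simp
  then show ?thesis
    using j
  proof (induction j rule: dec_induct)
    case base
    have "int l - 1 - int (l - 1) = int 0" using l by simp
    then show ?case
      using y l by (simp only: solves_ones_def)
  next
    case (step n)
    obtain j0 where "j0 < l" "0 < y j0"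
      using solves_ones_some_pos[OF y l(1)] by auto
    then have "toeplitz_row t l y (int l - 1 - int (Suc n)) < toeplitz_row t l y (int l - 1 - int (Suc n) + 1)"
      using y step.hyps step.prems size l by (intro row_less_next[of l y j0]) (auto simp: solves_ones_def)
    then show ?case
      using step.IH step.prems by (simp add: algebra_simps)
  qed
qed

text \<open>If row \<open>l\<close> pays more than one against \<open>z\<close>, then the total weight of \<open>y\<close> is both at least and
  less than that of \<open>z\<close>.\<close>

lemma solves_ones_maximal:
  assumes z: "solves_ones t l z" and l: "1 \<le> l" and above: "1 < toeplitz_row t l z (int l)"
    and k: "l < k" "k \<le> m"
  shows "\<not> solves_ones t k y"
proof
  assume y: "solves_ones t k y"
  have y0: "0 \<le> y j" if "j < k" for j using y that by (auto simp: solves_ones_def)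
  have y1: "toeplitz_row t k y (int i) = 1" if "i < k" for i using y that by (auto simp: solves_ones_def)
  have z_rows: "1 \<le> toeplitz_row t l z (int i)" if "i < m" for i
    using solves_ones_rows_beyond[OF z l above, of i] z that
    by (cases "i < l") (auto simp: solves_ones_def)
  \<comment> \<open>Exchanging sums with offset \<open>k - 1\<close> meets rows of \<open>z\<close>
    below \<open>k\<close>, all at least one and row \<open>k - 1\<close> greater; it has weight
    \<open>y 0 > 0\<close>. With offset \<open>l - 1\<close> the exchange meets columns against the
    reversed \<open>z\<close>, all at most one. On the side of \<open>y\<close>, both offsets meet
    only rows equal to one.\<close>
  have s1: "(\<Sum>j<k. y j * 1) < (\<Sum>j<k. y j * toeplitz_row t l z (int k - 1 - int j))"
  proof (rule sum_strict_mono_ex1)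
    have ij: "int k - 1 - int j = int (k - 1 - j)" if "j < k" for j using that by simp
    show "\<forall>j\<in>{..<k}. y j * 1 \<le> y j * toeplitz_row t l z (int k - 1 - int j)"
    proof
      fix j assume "j \<in> {..<k}"
      then have j: "j < k" by simp
      have "1 \<le> toeplitz_row t l z (int (k - 1 - j))"
        by (rule z_rows) (use k j in simp)
      then show "y j * 1 \<le> y j * toeplitz_row t l z (int k - 1 - int j)"
        unfolding ij[OF j] by (intro mult_left_mono y0 j)
    qed
    have "0 < y 0"
      using solves_ones_no_gap[OF y k(2), of 0] k l by simp
    moreover have "1 < toeplitz_row t l z (int (k - 1))"
      using solves_ones_rows_beyond[OF z l above, of "k - 1"] k by simp
    ultimately show "\<exists>j\<in>{..<k}. y j * 1 < y j * toeplitz_row t l z (int k - 1 - int j)"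
      using k ij[of 0] by (intro bexI[of _ 0]) simp_all
  qed simp
  have s2: "(\<Sum>j<k. y j * toeplitz_row t l z (int k - 1 - int j))
      = (\<Sum>j<l. z j * toeplitz_row t k y (int k - 1 - int j))"
    by (rule toeplitz_row_swap[where h = "int k - 1" and z = y])
  have s3: "(\<Sum>j<l. z j * toeplitz_row t k y (int k - 1 - int j)) = (\<Sum>j<l. z j * 1)"
  proof (rule sum.cong)
    fix j assume "j \<in> {..<l}"
    then have "int k - 1 - int j = int (k - 1 - j)" "k - 1 - j < k"
      using k by (simp_all add: of_nat_diff)
    then show "z j * toeplitz_row t k y (int k - 1 - int j) = z j * 1"
      by (simp only: y1)
  qed simp
  have s4: "(\<Sum>j<l. z j * 1) = (\<Sum>j<l. z j * toeplitz_row t k y (int l - 1 - int j))"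
  proof (rule sum.cong)
    fix j assume "j \<in> {..<l}"
    then have "int l - 1 - int j = int (l - 1 - j)" "l - 1 - j < k"
      using k by (simp_all add: of_nat_diff)
    then show "z j * 1 = z j * toeplitz_row t k y (int l - 1 - int j)"
      by (simp only: y1)
  qed simp
  have s5: "(\<Sum>j<l. z j * toeplitz_row t k y (int l - 1 - int j))
      = (\<Sum>j<k. y j * toeplitz_row t l z (int l - 1 - int j))"
    by (rule toeplitz_row_swap[where h = "int l - 1" and z = z])
  have s6: "(\<Sum>j<k. y j * toeplitz_row t l z (int l - 1 - int j)) \<le> (\<Sum>j<k. y j * 1)"
  proof (rule sum_mono)
    fix j assume "j \<in> {..<k}"
    then show "y j * toeplitz_row t l z (int l - 1 - int j) \<le> y j * 1"
      using y0[of j] solves_ones_columns[OF z l, of j] k size by (intro mult_left_mono) simp_all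
  qed
  show False
    using less_le_trans[OF s1[unfolded s2 s3 s4 s5] s6] by (rule less_irrefl[THEN notE])
qed

text \<open>Starting from \<open>1 / t 0\<close>, solutions are lengthened one bid at a time. If the
  next row ever paid more than one, the given solution of length \<open>k\<close> could not
  exist.\<close>

lemma solves_ones_shorter:
  assumes y: "solves_ones t k y" and k: "k \<le> m" and j: "1 \<le> j" "j \<le> k"
  shows "\<exists>z. solves_ones t j z"
  using j
proof (induction j rule: dec_induct)
  case base
  have "0 < t 0"
    using solves_ones_diagonal_pos[OF y] k base by simp
  then have "solves_ones t 1 (\<lambda>_. 1 / t 0)"
    by (auto simp: solves_ones_def toeplitz_row_def)
  then show ?case by blast
next
  case (step n)
  then obtain z where z: "solves_ones t n z" by force
  have "toeplitz_row t n z (int n) \<le> 1"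
  proof (rule ccontr)
    assume "\<not> ?thesis"
    then have "\<not> solves_ones t k y"
      using step.hyps step.prems k by (intro solves_ones_maximal[OF z]) auto
    then show False using y by blast
  qed
  then show ?case
    using step.hyps step.prems k by (intro solves_ones_extend[OF z]) auto
qed

text \<open>A solution that cannot be lengthened has row \<open>l\<close> paying more than one, and
  then so do all later rows. This is the guarantee of the column player.\<close>

lemma solves_ones_rows:
  assumes y: "solves_ones t l y" and l: "1 \<le> l"
    and longest: "l < m \<Longrightarrow> \<nexists>y'. solves_ones t (Suc l) y'" and i: "i < m"
  shows "1 \<le> toeplitz_row t l y (int i)"
proof (cases "i < l")
  case True
  then show ?thesis
    using y by (simp add: solves_ones_def)
next
  case False
  then have "1 < toeplitz_row t l y (int l)"
    using solves_ones_extend[OF y l] longest i by (meson le_less_trans not_le)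
  then show ?thesis
    using solves_ones_rows_beyond[OF y l, of i] i False by simp
qed

end

section \<open>Running time\<close>

lemma timed_simps [simp]:
  "result (tick r) = r" "cost (tick r) = 1"
  "result (bind_timed p f) = result (f (result p))"
  "cost (bind_timed p f) = cost p + cost (f (result p))"
  by (simp_all add: tick_def bind_timed_def)

lemma result_take_t [simp]: "result (take_t k ys) = take k ys"
  by (induction k ys rule: take_t.induct) auto

lemma cost_take_t: "cost (take_t k ys) \<le> Suc (length ys)"
  by (induction k ys rule: take_t.induct) auto

lemma snoc_t [simp]: "result (snoc_t ys z) = ys @ [z]" "cost (snoc_t ys z) = Suc (length ys)"
  by (induction ys) auto

lemma rev_append_t [simp]:
  "result (rev_append_t ys zs) = rev ys @ zs" "cost (rev_append_t ys zs) = Suc (length ys)"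
  by (induction ys arbitrary: zs) auto

lemma result_dot_t [simp]:
  "result (dot_t ys zs) = (\<Sum>i<min (length ys) (length zs). ys ! i * zs ! i)"
  by (induction ys zs rule: dot_t.induct) (auto simp: sum.lessThan_Suc_shift simp del: sum.lessThan_Suc)

text \<open>Measured by the second list, because the first is the whole remaining first row
  \<open>hs\<close> in one of the calls.\<close>

lemma cost_dot_t: "cost (dot_t ys zs) \<le> 2 * length zs + 1"
  by (induction ys zs rule: dot_t.induct) auto

lemma result_lincomb_t [simp]:
  "result (lincomb_t p ys q zs) = map2 (\<lambda>y z. p * y + q * z) ys zs"
  by (induction p ys q zs rule: lincomb_t.induct) auto

lemma cost_lincomb_t: "cost (lincomb_t p ys q zs) \<le> 4 * length ys + 1"
  by (induction p ys q zs rule: lincomb_t.induct) auto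

lemma sum_t [simp]: "result (sum_t ys) = sum_list ys" "cost (sum_t ys) = Suc (length ys)"
  by (induction ys) auto

lemma divide_t [simp]:
  "result (divide_t ys s) = map (\<lambda>y. y / s) ys" "cost (divide_t ys s) = Suc (2 * length ys)"
  by (induction ys) auto

lemma result_all_nonneg_t [simp]: "result (all_nonneg_t ys) \<longleftrightarrow> (\<forall>y\<in>set ys. 0 \<le> y)"
  by (induction ys) auto

lemma cost_all_nonneg_t: "cost (all_nonneg_t ys) \<le> Suc (length ys)"
  by (induction ys) auto

lemma result_tabulate_t [simp]: "result (tabulate_t g m k) = map (\<lambda>i. result (g i)) [m..<m + k]"
  by (induction g m k rule: tabulate_t.induct) (auto simp: upt_conv_Cons simp del: upt_Suc)

lemma cost_tabulate_t:
  assumes "\<And>i. cost (g i) \<le> C"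
  shows "cost (tabulate_t g m k) \<le> k * (C + 2) + 1"
proof (induction k arbitrary: m)
  case (Suc k)
  show ?case
    using Suc[of "Suc m"] assms[of m] by (simp add: algebra_simps)
qed simp

text \<open>Naming the intermediate vectors prevents the simplifier from copying them into one
  another. The 13 consists of eleven ticks and the extra cell of each of the two calls of
  \<open>snoc_t\<close>.\<close>

lemma levinson_t_Cons:
  assumes "past' = c # past"
    and "eu = result (dot_t past' u)" "ew = result (dot_t hs w)" "ey = result (dot_t past' y)"
    and "d = 1 - eu * ew"
    and "u' = result (lincomb_t (1 / d) (u @ [0]) (- eu / d) (0 # w))"
    and "w' = result (lincomb_t (1 / d) (0 # w) (- ew / d) (u @ [0]))"
    and "y' = result (lincomb_t 1 (y @ [0]) (1 - ey) w')"
  shows "result (levinson_t (c # cs) past hs u w y) =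
      (if d = 0 then None else result (levinson_t cs past' hs u' w' y'))"
    and "cost (levinson_t (c # cs) past hs u w y) =
      cost (dot_t past' u) + cost (dot_t hs w) + cost (dot_t past' y) +
      (if d = 0 then 5 else length u + length y + 13
        + cost (lincomb_t (1 / d) (u @ [0]) (- eu / d) (0 # w))
        + cost (lincomb_t (1 / d) (0 # w) (- ew / d) (u @ [0]))
        + cost (lincomb_t 1 (y @ [0]) (1 - ey) w')
        + cost (levinson_t cs past' hs u' w' y'))"
  unfolding assms by (simp_all del: result_dot_t result_lincomb_t)

lemma length_levinson_t:
  assumes "length u = k" "length w = k" "length y = k"
    and "result (levinson_t cs past hs u w y) = Some z"
  shows "length z = k + length cs"
  using assms
proof (induction cs arbitrary: k past u w y)
  case (Cons c cs)
  show ?case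
    using Cons.prems Cons.IH[where k = "Suc k"]
    by (force simp: levinson_t_Cons(1)[OF refl refl refl refl refl refl refl refl]
        simp del: levinson_t.simps split: if_splits)
qed simp

lemma cost_levinson_t:
  assumes "length u = k" "length w = k" "length y = k" "k + length cs \<le> N"
  shows "cost (levinson_t cs past hs u w y) \<le> length cs * (20 * N + 31) + 1"
  using assms
proof (induction cs arbitrary: k past u w y)
  case (Cons c cs)
  let ?past = "c # past"
  define eu where "eu = result (dot_t ?past u)"
  define ew where "ew = result (dot_t hs w)"
  define ey where "ey = result (dot_t ?past y)"
  define d where "d = 1 - eu * ew"
  define u' where "u' = result (lincomb_t (1 / d) (u @ [0]) (- eu / d) (0 # w))"
  define w' where "w' = result (lincomb_t (1 / d) (0 # w) (- ew / d) (u @ [0]))"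
  define y' where "y' = result (lincomb_t 1 (y @ [0]) (1 - ey) w')"
  have len: "length u' = Suc k" "length w' = Suc k" "length y' = Suc k"
    using Cons.prems by (simp_all add: u'_def w'_def y'_def)
  have IH: "cost (levinson_t cs ?past hs u' w' y') \<le> length cs * (20 * N + 31) + 1"
    using Cons.prems by (intro Cons.IH[OF len]) simp
  \<comment> \<open>\<open>20 * k + 31\<close> is \<open>3 * (2 * k + 1)\<close> for the inner
    products, \<open>2 * k + 13\<close> for the bookkeeping and \<open>3 * (4 * (k + 1) + 1)\<close>
    for the linear combinations.\<close>
  have "cost (levinson_t (c # cs) past hs u w y) \<le> 20 * k + 31 + (length cs * (20 * N + 31) + 1)"
    unfolding levinson_t_Cons(2)[OF refl eu_def ew_def ey_def d_def u'_def w'_def y'_def]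
    using cost_dot_t[of ?past u] cost_dot_t[of hs w] cost_dot_t[of ?past y]
      cost_lincomb_t[of "1 / d" "u @ [0]" "- eu / d" "0 # w"]
      cost_lincomb_t[of "1 / d" "0 # w" "- ew / d" "u @ [0]"]
      cost_lincomb_t[of 1 "y @ [0]" "1 - ey" w'] IH Cons.prems
    by (auto simp del: dot_t.simps lincomb_t.simps)
  also have "\<dots> \<le> length (c # cs) * (20 * N + 31) + 1"
    using Cons.prems by simp
  finally show ?case .
qed simp

lemma cost_toeplitz_solve_t:
  assumes "length vs \<le> n"
  shows "cost (toeplitz_solve_t vs hs) \<le> n * (20 * n + 31) + 3"
proof (cases "\<exists>c cs r hs'. vs = c # cs \<and> hs = r # hs' \<and> c \<noteq> 0")
  case True
  then obtain c cs r hs' where eq: "vs = c # cs" "hs = r # hs'" "c \<noteq> 0" by blast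
  have "cost (levinson_t cs [] hs' [1 / c] [1 / c] [1 / c]) \<le> length cs * (20 * n + 31) + 1"
    using assms eq by (intro cost_levinson_t[where k = 1]) auto
  also have "\<dots> \<le> n * (20 * n + 31) + 1"
    using assms eq by (intro add_right_mono mult_right_mono) auto
  finally show ?thesis
    using eq by simp
next
  case False
  then show ?thesis
    by (cases vs; cases hs) auto
qed

lemma length_toeplitz_solve_t:
  assumes "result (toeplitz_solve_t vs hs) = Some y"
  shows "length y = length vs"
proof (cases "\<exists>c cs r hs'. vs = c # cs \<and> hs = r # hs' \<and> c \<noteq> 0")
  case True
  then obtain c cs r hs' where eq: "vs = c # cs" "hs = r # hs'" "c \<noteq> 0" by blast
  show ?thesis
    using length_levinson_t[of "[1 / c]" 1 "[1 / c]" "[1 / c]" cs "[]" hs' y] eq assms by simp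
next
  case False
  then show ?thesis
    using assms by (cases vs; cases hs) (auto split: if_splits)
qed

definition length_test_cost :: "nat \<Rightarrow> nat" where
  "length_test_cost n = 20 * n * n + 33 * n + 6"

lemma cost_length_test_t:
  assumes "length vs \<le> n"
  shows "cost (length_test_t vs hs k) \<le> length_test_cost n"
proof -
  let ?sol = "toeplitz_solve_t (take k vs) hs"
  have "cost (case result ?sol of None \<Rightarrow> tick False | Some y \<Rightarrow> all_nonneg_t y) \<le> Suc n"
  proof (cases "result ?sol")
    case (Some y)
    then show ?thesis
      using length_toeplitz_solve_t[OF Some] cost_all_nonneg_t[of y] assms by simp
  qed simp
  moreover have "cost (take_t k vs) \<le> n + 1"
    using cost_take_t[of k vs] assms by simp
  moreover have "cost ?sol \<le> n * (20 * n + 31) + 3"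
    by (rule cost_toeplitz_solve_t) (use assms in simp)
  ultimately show ?thesis
    by (simp add: length_test_t_def length_test_cost_def algebra_simps)
qed

text \<open>\<open>2 ^ p\<close> bounds the width of the interval, which every round halves at the
  price of one test and four ticks.\<close>

lemma cost_search_t:
  assumes "length vs \<le> n" "hi \<le> lo + 2 ^ p"
  shows "cost (search_t vs hs lo hi) \<le> p * (length_test_cost n + 4) + 3"
  using assms(2)
proof (induction p arbitrary: lo hi)
  case 0
  then show ?case
    by (subst search_t.simps) simp
next
  case (Suc p)
  let ?k = "(lo + hi) div 2"
  show ?case
  proof (cases "hi \<le> Suc lo")
    case True
    then show ?thesis by (subst search_t.simps) simp
  next
    case False
    have "hi \<le> ?k + 2 ^ p" "?k \<le> lo + 2 ^ p"
      using Suc.prems by auto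
    then have "cost (search_t vs hs ?k hi) \<le> p * (length_test_cost n + 4) + 3"
      "cost (search_t vs hs lo ?k) \<le> p * (length_test_cost n + 4) + 3"
      by (simp_all only: Suc.IH)
    moreover have "cost (length_test_t vs hs ?k) \<le> length_test_cost n"
      by (rule cost_length_test_t[OF assms(1)])
    ultimately show ?thesis
      using False by (subst search_t.simps) simp
  qed
qed

text \<open>Valid for arbitrary lists, since a failed solve yields the empty strategy. The length
  bound later keeps the evaluation of the payoff quadratic.\<close>

lemma advantaged_strategy_t_bounds:
  assumes "length vs = n" "n \<le> 2 ^ p" "1 \<le> n"
  shows "cost (advantaged_strategy_t vs hs n) \<le>
      p * (length_test_cost n + 4) + (20 * n * n + 35 * n + 15)"
    and "length (result (advantaged_strategy_t vs hs n)) \<le> n"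
proof -
  define l where "l = result (search_t vs hs (Suc 0) (Suc n))"
  let ?vs = "take l vs"
  let ?sol = "toeplitz_solve_t ?vs hs"
  have s: "cost (search_t vs hs (Suc 0) (Suc n)) \<le> p * (length_test_cost n + 4) + 3"
    using assms by (intro cost_search_t) auto
  have sol: "cost ?sol \<le> n * (20 * n + 31) + 3"
    using assms by (intro cost_toeplitz_solve_t) simp
  have len: "length y \<le> n" if "result ?sol = Some y" for y
    using length_toeplitz_solve_t[OF that] assms by simp
  have rest: "cost (case result ?sol of None \<Rightarrow> tick []
      | Some y \<Rightarrow> do { s \<leftarrow> sum_t y; divide_t y s }) \<le> 3 * n + 2"
    using len by (cases "result ?sol") (simp_all add: mult_2)
  show "cost (advantaged_strategy_t vs hs n) \<le>
      p * (length_test_cost n + 4) + (20 * n * n + 35 * n + 15)"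
    using s sol rest cost_take_t[of l vs] assms
    by (cases "l = 1") (simp_all add: advantaged_strategy_t_def algebra_simps flip: l_def)
  show "length (result (advantaged_strategy_t vs hs n)) \<le> n"
    using len assms(3) by (auto simp: advantaged_strategy_t_def split: option.splits simp flip: l_def)
qed

lemma cost_adjusted_entry_t: "cost (adjusted_entry_t x a b M i j) \<le> 9"
  by (simp add: adjusted_entry_t_def)

lemma cost_diagonals_t: "cost (diagonals_t x a b M n) \<le> 22 * n + 3"
  using cost_tabulate_t[of "\<lambda>i. adjusted_entry_t x a b M i 0" 9 0 n]
    cost_tabulate_t[of "\<lambda>j. adjusted_entry_t x a b M 0 j" 9 0 n]
  by (simp add: diagonals_t_def cost_adjusted_entry_t)

lemma result_diagonals_t:
  "result (diagonals_t x a b M n) =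
     (map (\<lambda>i. result (adjusted_entry_t x a b M i 0)) [0..<n],
      map (\<lambda>j. result (adjusted_entry_t x a b M 0 j)) [0..<n])"
  by (simp add: diagonals_t_def)

lemma cost_row_payoff_t: "cost (row_payoff_t M i j ss) = 4 * length ss + 1"
  by (induction ss arbitrary: j) auto

lemma cost_payoff_t: "cost (payoff_t M i ss ts) = length ts * (4 * length ss + 4) + 1"
  by (induction ts arbitrary: i) (auto simp: cost_row_payoff_t)

lemma cost_solve_turn_t:
  assumes n: "n = Suc (min a b)" and p: "n \<le> 2 ^ p"
  shows "cost (solve_turn_t x a b M) \<le>
    p * (length_test_cost n + 4) + (24 * n * n + 62 * n + 30)"
proof -
  obtain vs hs where vh: "result (diagonals_t x a b M n) = (vs, hs)" by force
  then have len: "length vs = n"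
    by (auto simp: result_diagonals_t)
  let ?adv = "advantaged_strategy_t vs hs n"
  have "1 \<le> n" using n by simp
  note bounds = advantaged_strategy_t_bounds[OF len p this]
  define L where "L = length (result ?adv)"
  have L: "L \<le> n" using bounds(2) by (simp add: L_def)
  have eq: "Suc (if b \<le> a then b else a) = n" using n by auto
  have "L * (4 * L + 4) \<le> n * (4 * n + 4)"
    using L by (intro mult_mono) auto
  then show ?thesis
    using bounds(1)[of hs] cost_diagonals_t[of x a b M n] L
    unfolding solve_turn_t_def timed_simps eq vh prod.case
    by (cases "b \<le> a") (simp_all add: cost_payoff_t algebra_simps flip: L_def)
qed

lemma solve_turn_time:
  "\<exists>T :: nat \<Rightarrow> nat.
      (\<lambda>n. real (T n)) \<in> O(\<lambda>n. ln (real n) * (real n)\<^sup>2) \<and>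
      (\<forall>x a b M. cost (solve_turn_t x a b M) \<le> T (Suc (min a b)))"
proof -
  \<comment> \<open>The number of halvings from width \<open>n\<close>. The bound is asymptotic, so
    \<open>ln 1 = 0\<close> against \<open>T 1 > 0\<close> does no harm.\<close>
  define p where "p n = nat \<lceil>log 2 (real n)\<rceil>" for n
  define T where "T n = p n * (length_test_cost n + 4) + (24 * n * n + 62 * n + 30)" for n
  have "(\<lambda>n. real (p n)) \<in> O(\<lambda>n. ln (real n))"
    unfolding p_def by real_asymp
  moreover have "(\<lambda>n. real (length_test_cost n + 4)) \<in> O(\<lambda>n. (real n)\<^sup>2)"
    unfolding length_test_cost_def of_nat_add of_nat_mult by real_asymp
  ultimately have "(\<lambda>n. real (p n) * real (length_test_cost n + 4)) \<in> O(\<lambda>n. ln (real n) * (real n)\<^sup>2)"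
    by (rule landau_o.big.mult)
  moreover have "(\<lambda>n. real (24 * n * n + 62 * n + 30)) \<in> O(\<lambda>n. ln (real n) * (real n)\<^sup>2)"
    unfolding of_nat_add of_nat_mult by real_asymp
  ultimately have "(\<lambda>n. real (T n)) \<in> O(\<lambda>n. ln (real n) * (real n)\<^sup>2)"
    unfolding T_def of_nat_add[of "_ * _"] of_nat_mult[of "p _"] by (rule sum_in_bigo)
  moreover have "n \<le> 2 ^ p n" if "1 \<le> n" for n
  proof -
    have "real n = 2 powr log 2 (real n)"
      using that by simp
    also have "\<dots> \<le> 2 powr real (p n)"
      unfolding p_def by (intro powr_mono) (auto simp: real_nat_ceiling_ge)
    also have "\<dots> = real (2 ^ p n)"
      by (simp add: powr_realpow)
    finally show ?thesis
      by (simp only: of_nat_le_iff)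
  qed
  then have "cost (solve_turn_t x a b M) \<le> T (Suc (min a b))" for x a b M
    unfolding T_def by (intro cost_solve_turn_t) auto
  ultimately show ?thesis by blast
qed

section \<open>Correctness of the search\<close>

lemma toeplitz_row_snoc_0:
  assumes "length u = k"
  shows "toeplitz_row t (Suc k) (\<lambda>j. (u @ [0]) ! j) i = toeplitz_row t k (\<lambda>j. u ! j) i"
  using assms toeplitz_row_cong[of k "\<lambda>j. (u @ [0]) ! j" "\<lambda>j. u ! j"]
  by (simp add: toeplitz_row_Suc nth_append)

text \<open>Prepending a zero shifts the product down by one row. Row \<open>- 1\<close> thereby
  becomes row 0, and its value is the quantity \<open>ew\<close> of the recursion.\<close>

lemma toeplitz_row_Cons_0:
  "toeplitz_row t (Suc k) (\<lambda>j. (0 # w) ! j) i = toeplitz_row t k (\<lambda>j. w ! j) (i - 1)"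
  unfolding toeplitz_row_def
  by (subst sum.lessThan_Suc_shift) (auto intro!: sum.cong simp: algebra_simps)

lemma toeplitz_row_lincomb_t:
  assumes "length ys = k" "length zs = k"
  shows "toeplitz_row t k (\<lambda>j. result (lincomb_t p ys q zs) ! j) i =
    p * toeplitz_row t k (\<lambda>j. ys ! j) i + q * toeplitz_row t k (\<lambda>j. zs ! j) i"
  unfolding toeplitz_row_linear[symmetric] using assms by (intro toeplitz_row_cong) simp

text \<open>With \<open>d = 0\<close>, the vector \<open>ew * (u, 0) - (0, w)\<close> is in the kernel of the next matrix.\<close>

lemma levinson_t_correct:
  assumes "length u = k" "length w = k" "length y = k" "1 \<le> k" "u ! 0 \<noteq> 0"
    and "length past = k - 1" "\<And>i. i < k - 1 \<Longrightarrow> past ! i = t (int (k - 1 - i))"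
    and "\<And>i. i < length cs \<Longrightarrow> cs ! i = t (int (k + i))"
    and "k + length cs \<le> Suc (length hs)" "\<And>i. i < length hs \<Longrightarrow> hs ! i = t (- int (Suc i))"
    and "\<And>i. i < k \<Longrightarrow> toeplitz_row t k (\<lambda>j. u ! j) (int i) = (if i = 0 then 1 else 0)"
    and "\<And>i. i < k \<Longrightarrow> toeplitz_row t k (\<lambda>j. w ! j) (int i) = (if Suc i = k then 1 else 0)"
    and "\<And>i. i < k \<Longrightarrow> toeplitz_row t k (\<lambda>j. y ! j) (int i) = 1"
  shows "case result (levinson_t cs past hs u w y) of
      Some z \<Rightarrow> \<forall>i<k + length cs. toeplitz_row t (k + length cs) (\<lambda>j. z ! j) (int i) = 1
    | None \<Rightarrow> \<exists>j. k < j \<and> j \<le> k + length cs \<and> \<not> toeplitz_nonsingular t j"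
  using assms
proof (induction cs arbitrary: k past u w y)
  case Nil
  then show ?case by simp
next
  case (Cons c cs)
  note len = Cons.prems(1-3) and k = Cons.prems(4) and hs = Cons.prems(9,10)
  define past' where "past' = c # past"
  define eu where "eu = result (dot_t past' u)"
  define ew where "ew = result (dot_t hs w)"
  define ey where "ey = result (dot_t past' y)"
  define d where "d = 1 - eu * ew"
  define u' where "u' = result (lincomb_t (1 / d) (u @ [0]) (- eu / d) (0 # w))"
  define w' where "w' = result (lincomb_t (1 / d) (0 # w) (- ew / d) (u @ [0]))"
  define y' where "y' = result (lincomb_t 1 (y @ [0]) (1 - ey) w')"
  note step = levinson_t_Cons(1)[OF past'_def eu_def ew_def ey_def d_def u'_def w'_def y'_def]
  have past_len: "length past' = k"
    using Cons.prems(6) k by (simp add: past'_def)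
  have past: "past' ! i = t (int (k - i))" if "i < k" for i
  proof (cases i)
    case 0
    then show ?thesis
      using Cons.prems(8)[of 0] by (simp add: past'_def)
  next
    case (Suc i')
    then have "past ! i' = t (int (k - 1 - i'))" using that by (intro Cons.prems(7)) simp
    then show ?thesis using Suc by (simp add: past'_def)
  qed
  have dot: "result (dot_t past' v) = toeplitz_row t k (\<lambda>j. v ! j) (int k)" if "length v = k" for v
    using that past_len past by (auto simp: toeplitz_row_def of_nat_diff intro!: sum.cong)
  have eu: "toeplitz_row t k (\<lambda>j. u ! j) (int k) = eu"
    and ey: "toeplitz_row t k (\<lambda>j. y ! j) (int k) = ey"
    using dot len by (simp_all add: eu_def ey_def del: result_dot_t)
  have ew: "toeplitz_row t k (\<lambda>j. w ! j) (- 1) = ew"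
    unfolding ew_def result_dot_t toeplitz_row_def using len hs
    by (intro sum.cong) (auto simp: algebra_simps)
  have row_u: "toeplitz_row t (Suc k) (\<lambda>j. (u @ [0]) ! j) (int i) =
      (if i = 0 then 1 else if i = k then eu else 0)" if "i < Suc k" for i
    using that eu Cons.prems(11)[of i] len k by (auto simp: toeplitz_row_snoc_0 less_Suc_eq)
  have row_w: "toeplitz_row t (Suc k) (\<lambda>j. (0 # w) ! j) (int i) =
      (if i = 0 then ew else if i = k then 1 else 0)" if "i < Suc k" for i
    unfolding toeplitz_row_Cons_0
    using that ew Cons.prems(12)[of "i - 1"] k by (cases i) auto
  have row_y: "toeplitz_row t (Suc k) (\<lambda>j. (y @ [0]) ! j) (int i) = (if i = k then ey else 1)"
    if "i < Suc k" for i
    using that ey Cons.prems(13)[of i] len by (auto simp: toeplitz_row_snoc_0 less_Suc_eq)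
  show ?case
  proof (cases "d = 0")
    case True
    have "toeplitz_row t (Suc k) (\<lambda>j. ew * (u @ [0]) ! j + (- 1) * (0 # w) ! j) (int i) = 0"
      if "i < Suc k" for i
      unfolding toeplitz_row_linear row_u[OF that] row_w[OF that]
      using True k by (auto simp: d_def mult.commute)
    \<comment> \<open>\<open>d = 0\<close> means \<open>eu * ew = 1\<close>, so \<open>ew\<close> is
      nonzero. The invariant \<open>u ! 0 \<noteq> 0\<close> is carried along for this
      point.\<close>
    moreover have "ew * (u @ [0]) ! 0 + (- 1) * (0 # w) ! 0 \<noteq> 0"
      using True len k Cons.prems(5) by (auto simp: d_def nth_append)
    ultimately have "\<not> toeplitz_nonsingular t (Suc k)"
      unfolding toeplitz_nonsingular_def by blast
    then show ?thesis
      unfolding step using True by auto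
  next
    case False
    \<comment> \<open>On rows 0 and \<open>k\<close>, the vectors \<open>(u, 0)\<close> and
      \<open>(0, w)\<close> give the pairs \<open>(1, eu)\<close> and \<open>(ew, 1)\<close>, with
      determinant \<open>d\<close>; \<open>u'\<close> and \<open>w'\<close> are the combinations
      that invert this system.\<close>
    have d: "1 / d - eu / d * ew = 1" "1 / d - ew / d * eu = 1"
      using False by (simp_all add: d_def field_simps)
    have row_u': "toeplitz_row t (Suc k) (\<lambda>j. u' ! j) (int i) = (if i = 0 then 1 else 0)"
      if "i < Suc k" for i
      using d k unfolding u'_def
      by (subst toeplitz_row_lincomb_t) (auto simp: len row_u row_w that simp del: nth_Cons_0)
    have row_w': "toeplitz_row t (Suc k) (\<lambda>j. w' ! j) (int i) = (if Suc i = Suc k then 1 else 0)"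
      if "i < Suc k" for i
      using d k unfolding w'_def
      by (subst toeplitz_row_lincomb_t) (auto simp: len row_u row_w that)
    have row_y': "toeplitz_row t (Suc k) (\<lambda>j. y' ! j) (int i) = 1" if "i < Suc k" for i
      using row_w'[OF that] unfolding y'_def
      by (subst toeplitz_row_lincomb_t) (auto simp: len row_y that w'_def)
    have "case result (levinson_t cs past' hs u' w' y') of
        Some z \<Rightarrow> \<forall>i<Suc k + length cs. toeplitz_row t (Suc k + length cs) (\<lambda>j. z ! j) (int i) = 1
      | None \<Rightarrow> \<exists>j. Suc k < j \<and> j \<le> Suc k + length cs \<and> \<not> toeplitz_nonsingular t j"
    proof (rule Cons.IH)
      show "length u' = Suc k" "length w' = Suc k" "length y' = Suc k"
        using len by (simp_all add: u'_def w'_def y'_def)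
      show "u' ! 0 \<noteq> 0"
        using Cons.prems(5) False len k by (simp add: u'_def nth_append)
      show "past' ! i = t (int (Suc k - 1 - i))" if "i < Suc k - 1" for i
        using past that by simp
      show "cs ! i = t (int (Suc k + i))" if "i < length cs" for i
        using Cons.prems(8)[of "Suc i"] that by simp
    qed (use past_len hs row_u' row_w' row_y' in auto)
    then show ?thesis
      unfolding step using False by (auto split: option.splits intro: Suc_lessD)
  qed
qed

lemma toeplitz_solve_t_correct:
  assumes vs: "length vs = k" "1 \<le> k" "\<And>i. i < k \<Longrightarrow> vs ! i = t (int i)"
    and hs: "k \<le> length hs" "\<And>i. i < length hs \<Longrightarrow> hs ! i = t (- int i)"
  shows "case result (toeplitz_solve_t vs hs) of
      Some z \<Rightarrow> length z = k \<and> (\<forall>i<k. toeplitz_row t k (\<lambda>j. z ! j) (int i) = 1)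
    | None \<Rightarrow> \<exists>j. 1 \<le> j \<and> j \<le> k \<and> \<not> toeplitz_nonsingular t j"
proof -
  obtain c cs where cs: "vs = c # cs" using vs by (cases vs) auto
  obtain r hs' where hs': "hs = r # hs'" using vs hs by (cases hs) auto
  have c: "c = t 0" using vs(3)[of 0] vs(2) cs by simp
  show ?thesis
  proof (cases "c = 0")
    case True
    then have "\<not> toeplitz_nonsingular t 1"
      using c by (auto simp: toeplitz_nonsingular_def toeplitz_row_def intro!: exI[of _ "\<lambda>_. 1"])
    then show ?thesis
      using True cs hs' vs(2) by auto
  next
    case False
    have "case result (levinson_t cs [] hs' [1 / c] [1 / c] [1 / c]) of
        Some z \<Rightarrow> \<forall>i<1 + length cs. toeplitz_row t (1 + length cs) (\<lambda>j. z ! j) (int i) = 1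
      | None \<Rightarrow> \<exists>j. 1 < j \<and> j \<le> 1 + length cs \<and> \<not> toeplitz_nonsingular t j"
    proof (rule levinson_t_correct)
      show "cs ! i = t (int (1 + i))" if "i < length cs" for i
        using vs(3)[of "Suc i"] vs(1) that cs by simp
      show "hs' ! i = t (- int (Suc i))" if "i < length hs'" for i
        using hs(2)[of "Suc i"] that hs' by simp
    qed (use False c cs hs' vs hs in \<open>auto simp: toeplitz_row_def\<close>)
    moreover have eq: "result (levinson_t cs [] hs' [1 / c] [1 / c] [1 / c]) = result (toeplitz_solve_t vs hs)"
      "1 + length cs = k"
      using False cs hs' vs(1) by simp_all
    ultimately have correct: "case result (toeplitz_solve_t vs hs) of
        Some z \<Rightarrow> \<forall>i<k. toeplitz_row t k (\<lambda>j. z ! j) (int i) = 1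
      | None \<Rightarrow> \<exists>j. 1 < j \<and> j \<le> k \<and> \<not> toeplitz_nonsingular t j"
      by (simp only: eq)
    show ?thesis
    proof (cases "result (toeplitz_solve_t vs hs)")
      case None
      then obtain j where "1 < j" "j \<le> k" "\<not> toeplitz_nonsingular t j"
        using correct by auto
      then show ?thesis
        unfolding None by (auto intro!: exI[of _ j])
    next
      case (Some z)
      then show ?thesis
        using correct length_toeplitz_solve_t[OF Some] vs(1) by simp
    qed
  qed
qed

context toeplitz_game
begin

text \<open>The recursion fails only at a singular leading submatrix. A nonnegative solution of
  length \<open>k\<close> yields one of every smaller length, hence nonsingularity at each;
  uniqueness then identifies the output with \<open>y\<close>.\<close>

lemma toeplitz_solve_t_solves_ones:
  assumes vs: "length vs = k" "1 \<le> k" "k \<le> m" "\<And>i. i < k \<Longrightarrow> vs ! i = t (int i)"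
    and hs: "k \<le> length hs" "\<And>i. i < length hs \<Longrightarrow> hs ! i = t (- int i)"
    and y: "solves_ones t k y"
  shows "\<exists>z. result (toeplitz_solve_t vs hs) = Some z \<and> length z = k \<and> solves_ones t k (\<lambda>j. z ! j)"
proof -
  note correct = toeplitz_solve_t_correct[of vs k t hs, OF vs(1,2,4) hs]
  have nonsing: "toeplitz_nonsingular t j" if "1 \<le> j" "j \<le> k" for j
    using solves_ones_shorter[OF y vs(3) that] solves_ones_nonsingular that vs(3) by fastforce
  show ?thesis
  proof (cases "result (toeplitz_solve_t vs hs)")
    case None
    then show ?thesis
      using correct nonsing by auto
  next
    case (Some z)
    then have z: "length z = k" "\<And>i. i < k \<Longrightarrow> toeplitz_row t k (\<lambda>j. z ! j) (int i) = 1"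
      using correct by auto
    have rows: "toeplitz_row t k (\<lambda>j. z ! j) (int i) = toeplitz_row t k y (int i)" if "i < k" for i
      using z(2)[OF that] y that by (simp add: solves_ones_def)
    have "z ! j = y j" if "j < k" for j
      using toeplitz_nonsingularD[OF nonsing[OF vs(2) order_refl] rows that] .
    then have "solves_ones t k (\<lambda>j. z ! j)"
      using z(2) y by (simp add: solves_ones_def)
    then show ?thesis
      using Some z(1) by blast
  qed
qed

lemma length_test_t_correct:
  assumes vs: "length vs = m" "\<And>i. i < m \<Longrightarrow> vs ! i = t (int i)"
    and hs: "length hs = m" "\<And>i. i < m \<Longrightarrow> hs ! i = t (- int i)"
    and k: "1 \<le> k" "k \<le> m"
  shows "result (length_test_t vs hs k) \<longleftrightarrow> (\<exists>y. solves_ones t k y)"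
proof
  have take: "length (take k vs) = k" "\<And>i. i < k \<Longrightarrow> take k vs ! i = t (int i)"
    using vs k by auto
  have hs': "k \<le> length hs" "\<And>i. i < length hs \<Longrightarrow> hs ! i = t (- int i)"
    using hs k by auto
  show "\<exists>y. solves_ones t k y" if "result (length_test_t vs hs k)"
  proof (cases "result (toeplitz_solve_t (take k vs) hs)")
    case None
    then show ?thesis using that by (simp add: length_test_t_def)
  next
    case (Some z)
    then have "solves_ones t k (\<lambda>j. z ! j)"
      using that toeplitz_solve_t_correct[of "take k vs" k t hs, OF take(1) k(1) take(2) hs']
      by (auto simp: length_test_t_def solves_ones_def)
    then show ?thesis by blast
  qed
  show "result (length_test_t vs hs k)" if ex: "\<exists>y. solves_ones t k y"
  proof -
    obtain y where "solves_ones t k y" using ex by blast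
    then obtain z where "result (toeplitz_solve_t (take k vs) hs) = Some z" "length z = k"
      "solves_ones t k (\<lambda>j. z ! j)"
      using toeplitz_solve_t_solves_ones[OF take(1) k take(2) hs'] by blast
    then show ?thesis
      by (auto simp: length_test_t_def solves_ones_def in_set_conv_nth)
  qed
qed

text \<open>Only \<open>k\<close> with \<open>lo < k < hi\<close> are tested, so the tested lengths
  lie between 2 and \<open>m\<close>, as in the assumption \<open>test\<close>.\<close>

lemma search_t_correct:
  assumes test: "\<And>k. 1 < k \<Longrightarrow> k \<le> m \<Longrightarrow> result (length_test_t vs hs k) \<longleftrightarrow> k \<le> l"
    and "1 \<le> lo" "lo \<le> l" "l < hi" "hi \<le> Suc m"
  shows "result (search_t vs hs lo hi) = l"
  using assms(2-)
proof (induction "hi - lo" arbitrary: lo hi rule: less_induct)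
  case less
  let ?k = "(lo + hi) div 2"
  show ?case
  proof (cases "hi \<le> Suc lo")
    case True
    then show ?thesis
      using less.prems by (subst search_t.simps) simp
  next
    case False
    then have k: "lo < ?k" "?k < hi" by auto
    then have "result (length_test_t vs hs ?k) \<longleftrightarrow> ?k \<le> l"
      using less.prems by (intro test) auto
    then show ?thesis
      using False k less.prems less.hyps[of hi ?k] less.hyps[of ?k lo]
      by (subst search_t.simps) (auto simp: not_le)
  qed
qed

lemma advantaged_strategy_t_correct:
  assumes vs: "length vs = m" "\<And>i. i < m \<Longrightarrow> vs ! i = t (int i)"
    and hs: "length hs = m" "\<And>i. i < m \<Longrightarrow> hs ! i = t (- int i)"
    and adv: "adv = result (advantaged_strategy_t vs hs m)"
  obtains v where "1 \<le> length adv" "length adv \<le> m" "\<And>j. j < length adv \<Longrightarrow> 0 \<le> adv ! j"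
    "(\<Sum>j<length adv. adv ! j) = 1"
    "\<And>i. i < m \<Longrightarrow> v \<le> toeplitz_row t (length adv) (\<lambda>j. adv ! j) (int i)"
    "\<And>j. j < c \<Longrightarrow> toeplitz_row t (length adv) (\<lambda>j. adv ! j) (int (length adv) - 1 - int j) \<le> v"
proof -
  \<comment> \<open>Length one is inserted as the default, because for \<open>t 0 = 0\<close> no
    length is solvable.\<close>
  define l where "l = Max ({1} \<union> {k. 1 \<le> k \<and> k \<le> m \<and> (\<exists>y. solves_ones t k y)})"
  have fin: "finite ({1} \<union> {k. 1 \<le> k \<and> k \<le> m \<and> (\<exists>y. solves_ones t k y)})"
    by (rule finite_subset[of _ "{..m}"]) (use size in auto)
  have l_in: "l = 1 \<or> (1 \<le> l \<and> l \<le> m \<and> (\<exists>y. solves_ones t l y))"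
    using Max_in[OF fin] unfolding l_def[symmetric] by blast
  have l_max: "k \<le> l" if "1 \<le> k" "k \<le> m" "solves_ones t k y" for k y
    unfolding l_def using that by (intro Max_ge[OF fin]) blast
  have l: "1 \<le> l" "l \<le> m" using l_in size by auto
  have test: "result (length_test_t vs hs k) \<longleftrightarrow> k \<le> l" if k: "1 < k" "k \<le> m" for k
  proof -
    have "k \<le> l \<Longrightarrow> \<exists>y. solves_ones t k y"
      using l_in solves_ones_shorter[of l _ k] k l by auto
    then show ?thesis
      using length_test_t_correct[OF vs hs, of k] l_max[of k] k by auto
  qed
  have search: "result (search_t vs hs 1 (Suc m)) = l"
    using l by (intro search_t_correct test) auto
  show ?thesis
  proof (cases "\<exists>y. solves_ones t l y")
    case True
    then obtain y where y: "solves_ones t l y" by blast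
    have "\<exists>z. result (toeplitz_solve_t (take l vs) hs) = Some z \<and> length z = l
        \<and> solves_ones t l (\<lambda>j. z ! j)"
      by (rule toeplitz_solve_t_solves_ones[OF _ l _ _ _ y]) (use vs hs l in simp_all)
    then obtain z where z: "result (toeplitz_solve_t (take l vs) hs) = Some z" "length z = l"
      "solves_ones t l (\<lambda>j. z ! j)"
      by blast
    define S where "S = (\<Sum>j<l. z ! j)"
    obtain j0 where "j0 < l" "0 < z ! j0"
      using solves_ones_some_pos[OF z(3) l(1)] by blast
    then have S: "0 < S"
      unfolding S_def using z(3) by (intro sum_pos2[of _ j0]) (auto simp: solves_ones_def)
    have adv_eq: "adv = map (\<lambda>y. y / S) z"
    proof (cases "l = 1")
      case True
      then obtain z0 where "z = [z0]" using z(2) by (auto simp: length_Suc_conv)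
      then show ?thesis
        using True search S by (simp add: adv advantaged_strategy_t_def S_def)
    next
      case False
      then show ?thesis
        using search z by (simp add: adv advantaged_strategy_t_def S_def sum_list_sum_nth atLeast0LessThan)
    qed
    have row: "toeplitz_row t l (\<lambda>j. adv ! j) i = toeplitz_row t l (\<lambda>j. z ! j) i / S" for i
      using z(2) by (simp add: toeplitz_row_def adv_eq sum_divide_distrib)
    have len: "length adv = l" using z(2) adv_eq by simp
    show ?thesis
    proof (rule that[of "1 / S"]; unfold len)
      show "0 \<le> adv ! j" if "j < l" for j
        using that z S by (simp add: adv_eq solves_ones_def)
      show "(\<Sum>j<l. adv ! j) = 1"
        using z(2) S by (simp add: adv_eq S_def flip: sum_divide_distrib)
      show "1 / S \<le> toeplitz_row t l (\<lambda>j. adv ! j) (int i)" if "i < m" for i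
      proof -
        have "\<nexists>y'. solves_ones t (Suc l) y'" if "l < m"
          using l_max[of "Suc l"] that by auto
        then show ?thesis
          unfolding row using solves_ones_rows[OF z(3) l(1) _ \<open>i < m\<close>] S by (intro divide_right_mono) auto
      qed
      show "toeplitz_row t l (\<lambda>j. adv ! j) (int l - 1 - int j) \<le> 1 / S" if "j < c" for j
        unfolding row using solves_ones_columns[OF z(3) l that] S by (intro divide_right_mono) auto
    qed (use l in auto)
  next
    case False
    then have l1: "l = 1" using l_in by blast
    then have adv1: "adv = [1]"
      using search by (simp add: adv advantaged_strategy_t_def)
    \<comment> \<open>An unsolvable length one excludes \<open>t 0 > 0\<close>, so the opponent's
      only bid is 0. Bidding 0 is then best, as \<open>t\<close> increases up to index 0.\<close>
    have "m = 1"
    proof (rule ccontr)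
      assume "m \<noteq> 1"
      then have "0 < t 0" using diagonal_pos size by simp
      then have "solves_ones t 1 (\<lambda>_. 1 / t 0)"
        by (simp add: solves_ones_def toeplitz_row_def)
      then show False using False l1 by blast
    qed
    have cols: "t (- int j) \<le> t 0" if "j < c" for j
      using that
    proof (induction j)
      case (Suc j)
      then show ?case
        using incr_neg[of "- int (Suc j)"] by simp
    qed simp
    show ?thesis
      by (rule that[of "t 0"]) (use \<open>m = 1\<close> cols in \<open>auto simp: adv1 toeplitz_row_def\<close>)
  qed
qed

end

section \<open>The payoff matrix of a turn\<close>

lemma dim_adjusted_matrix [simp]:
  "dim_row (adjusted_matrix x c M) = dim_row M" "dim_col (adjusted_matrix x c M) = dim_col M"
  by (simp_all add: adjusted_matrix_def)

lemma advantaged_matrix_entry: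
  assumes "dim_row M = Suc b" "dim_col M = Suc a" "i \<le> min a b" "j \<le> max a b"
  shows "advantaged_matrix x a b M $$ (i, j) =
    (if b \<le> a then M $$ (i, j) + x * real (a - j + i) else 1 - M $$ (j, i) + x * real (b - j + i))"
  using assms by (auto simp: advantaged_matrix_def adjusted_matrix_def swap_players_def)

lemma result_adjusted_entry_t:
  assumes "dim_row M = Suc b" "dim_col M = Suc a" "i \<le> min a b" "j \<le> max a b"
  shows "result (adjusted_entry_t x a b M i j) = advantaged_matrix x a b M $$ (i, j)"
  unfolding advantaged_matrix_entry[OF assms] by (simp add: adjusted_entry_t_def)

text \<open>\<open>k\<close> is the opponent's bid minus one's own, so \<open>own + k\<close> is the
  chip count after the turn. \<open>f\<close> is the payoff after a won bid, ties included, and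
  \<open>g\<close> after a lost one.\<close>

lemma toeplitz_game_of_chips:
  fixes f g :: "nat \<Rightarrow> real"
  assumes "opp \<le> own" "0 \<le> x"
    and mono: "\<And>c. c < own + opp \<Longrightarrow> f c \<le> f (Suc c) \<and> g c \<le> g (Suc c)"
    and strict: "\<And>c. x = 0 \<Longrightarrow> c < own + opp \<Longrightarrow> f c < f (Suc c) \<and> g c < g (Suc c)"
    and nonneg: "\<And>c. c \<le> own + opp \<Longrightarrow> 0 \<le> f c \<and> 0 \<le> g c"
  shows "toeplitz_game (\<lambda>k. (if k \<le> 0 then f (nat (int own + k)) else g (nat (int own + k)))
      + x * (real own + of_int k)) (Suc opp) (Suc own)"
    (is "toeplitz_game ?t _ _")
proof
  have less: "f c + x * real c < f (Suc c) + x * real (Suc c)"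
    "g c + x * real c < g (Suc c) + x * real (Suc c)" if "c < own + opp" for c
    using mono[OF that] strict[OF _ that] \<open>0 \<le> x\<close>
    by (cases "x = 0"; simp add: distrib_left add.commute add_le_less_mono)+
  have t: "?t (int c - int own) = (if c \<le> own then f c else g c) + x * real c" for c
    by simp
  show "?t k < ?t (k + 1)" if "- int (Suc own) < k" "k < 0" for k
  proof -
    define c where "c = nat (int own + k)"
    have k: "k = int c - int own" "k + 1 = int (Suc c) - int own" using that by (simp_all add: c_def)
    have "?t (int c - int own) < ?t (int (Suc c) - int own)"
      unfolding t using less(1)[of c] that k assms(1) by (auto simp del: of_nat_Suc)
    then show ?thesis
      unfolding k(2) unfolding k(1) .
  qed
  show "?t k < ?t (k + 1)" if "1 \<le> k" "k + 1 < int (Suc opp)" for k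
  proof -
    define c where "c = nat (int own + k)"
    have k: "k = int c - int own" "k + 1 = int (Suc c) - int own" using that by (simp_all add: c_def)
    have "?t (int c - int own) < ?t (int (Suc c) - int own)"
      unfolding t using less(2)[of c] that k assms(1) by (auto simp del: of_nat_Suc)
    then show ?thesis
      unfolding k(2) unfolding k(1) .
  qed
  show "0 \<le> ?t k" if "- int (Suc own) < k" "k < int (Suc opp)" for k
  proof -
    define c where "c = nat (int own + k)"
    have k: "k = int c - int own" "c \<le> own + opp" using that by (simp_all add: c_def)
    show ?thesis
      unfolding k(1) t using nonneg[OF k(2)] \<open>0 \<le> x\<close> by simp
  qed
  show "0 < ?t 0" if opp: "1 < Suc opp"
  proof -
    \<comment> \<open>The diagonal payoff strictly exceeds the nonnegative payoff with one chip
      fewer.\<close>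
    obtain c where c: "own = Suc c" using opp assms(1) by (cases own) auto
    have "0 \<le> f c + x * real c" "f c + x * real c < f own + x * real own"
      using nonneg[of c] less(1)[of c] \<open>0 \<le> x\<close> c by simp_all
    then show ?thesis by simp
  qed
qed (use assms(1) in simp_all)

context bidding_game
begin

text \<open>The total \<open>N\<close> survives the turn, so the chips \<open>c\<close> of
  \<open>A\<close> determine the split. This dependence on one number is what makes the payoff
  matrix Toeplitz.\<close>

definition best_red :: "'v \<Rightarrow> nat \<Rightarrow> nat \<Rightarrow> real" where
  "best_red G N c = Max ((\<lambda>G'. v_A G' c (N - c)) ` (red `` {G}))"

definition best_blue :: "'v \<Rightarrow> nat \<Rightarrow> nat \<Rightarrow> real" where
  "best_blue G N c = Min ((\<lambda>G'. v_A G' c (N - c)) ` (blue `` {G}))"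

lemma best_move_bounds:
  assumes "G \<in> V - {goal_A, goal_B}"
  shows "0 \<le> best_red G N c \<and> best_red G N c \<le> 1" "0 \<le> best_blue G N c \<and> best_blue G N c \<le> 1"
  unfolding best_red_def best_blue_def
  using moves_A[OF assms] moves_B[OF assms] moves_finite moves_in v_A_bounds
  by (intro Max_image_bounds Min_image_bounds; blast)+

lemma best_move_mono:
  assumes "G \<in> V - {goal_A, goal_B}" "c < N"
  shows "best_red G N c \<le> best_red G N (Suc c)" "best_blue G N c \<le> best_blue G N (Suc c)"
proof -
  have N: "N - c = Suc (N - Suc c)" using assms(2) by simp
  have "v_A G' c (N - c) \<le> v_A G' (Suc c) (N - Suc c)" if "G' \<in> red `` {G} \<union> blue `` {G}" for G'
    unfolding N by (rule v_A_extra_chip[OF moves_in[OF that]])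
  then show "best_red G N c \<le> best_red G N (Suc c)" "best_blue G N c \<le> best_blue G N (Suc c)"
    unfolding best_red_def best_blue_def
    using moves_A[OF assms(1)] moves_B[OF assms(1)] moves_finite
    by (intro Max_image_mono Min_image_mono; blast)+
qed

lemma best_move_strict_mono:
  assumes "G \<in> V - {goal_A, goal_B}" "precise G a b" "c < a + b"
  shows "best_red G (a + b) c < best_red G (a + b) (Suc c)"
    "best_blue G (a + b) c < best_blue G (a + b) (Suc c)"
  unfolding best_red_def best_blue_def
  using moves_A[OF assms(1)] moves_B[OF assms(1)] moves_finite assms(2,3)
  by (intro Max_image_strict_mono Min_image_strict_mono; auto simp: precise_def)+

lemma dim_payoff_matrix [simp]:
  "dim_row (payoff_matrix G a b) = Suc b" "dim_col (payoff_matrix G a b) = Suc a"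
  by (simp_all add: payoff_matrix_def)

lemma payoff_matrix_entry:
  assumes "i \<le> b" "j \<le> a" "N = a + b" "c = a - j + i"
  shows "payoff_matrix G a b $$ (i, j) =
    (if i < j \<or> (i = j \<and> b \<le> a) then max (best_red G N c) (best_blue G N c)
     else min (best_red G N c) (best_blue G N c))"
proof -
  have "b - i + j = N - c" using assms by simp
  then show ?thesis
    unfolding payoff_matrix_def turn_matrix_entry[OF assms(1,2)] Let_def best_red_def best_blue_def
    by (simp flip: assms(4))
qed

lemma game_value_payoff_matrix:
  assumes "G \<in> V - {goal_A, goal_B}"
  shows "game_value (payoff_matrix G a b) = v_A G a b"
  using assms by (subst v_A.simps) (simp add: payoff_matrix_def)

lemma advantaged_matrix_toeplitz:
  assumes G: "G \<in> V - {goal_A, goal_B}" and x: "0 < x \<or> (x = 0 \<and> precise G a b)"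
  obtains t where "toeplitz_game t (Suc (min a b)) (Suc (max a b))"
    "\<And>i j. i \<le> min a b \<Longrightarrow> j \<le> max a b \<Longrightarrow>
       advantaged_matrix x a b (payoff_matrix G a b) $$ (i, j) = t (int i - int j)"
proof -
  define N where "N = a + b"
  let ?p = "best_red G N" and ?q = "best_blue G N"
  have x0: "0 \<le> x" using x by auto
  note bounds = best_move_bounds[OF G, of N]
  have mono: "?p c \<le> ?p (Suc c)" "?q c \<le> ?q (Suc c)" if "c < N" for c
    using best_move_mono[OF G that] by simp_all
  have strict: "?p c < ?p (Suc c)" "?q c < ?q (Suc c)" if "x = 0" "c < N" for c
    using best_move_strict_mono[OF G, of a b c] x that by (auto simp: N_def)
  show ?thesis
  proof (cases "b \<le> a")
    case True
    let ?f = "\<lambda>c. max (?p c) (?q c)" and ?g = "\<lambda>c. min (?p c) (?q c)"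
    let ?t = "\<lambda>k. (if k \<le> 0 then ?f (nat (int a + k)) else ?g (nat (int a + k))) + x * (real a + of_int k)"
    have "toeplitz_game ?t (Suc b) (Suc a)"
    proof (rule toeplitz_game_of_chips[OF True x0])
      fix c
      show "?f c \<le> ?f (Suc c) \<and> ?g c \<le> ?g (Suc c)" if "c < a + b"
        using mono[of c] that by (auto simp: N_def max_def min_def)
      show "?f c < ?f (Suc c) \<and> ?g c < ?g (Suc c)" if "x = 0" "c < a + b"
        using strict[of c] that by (auto simp: N_def max_def min_def)
      show "0 \<le> ?f c \<and> 0 \<le> ?g c"
        using bounds[of c] by (simp add: le_max_iff_disj)
    qed
    moreover have "advantaged_matrix x a b (payoff_matrix G a b) $$ (i, j) = ?t (int i - int j)"
      if ij: "i \<le> min a b" "j \<le> max a b" for i j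
    proof -
      have c: "nat (int a + (int i - int j)) = a - j + i" "real a + of_int (int i - int j) = real (a - j + i)"
        using ij True by auto
      show ?thesis
        unfolding c using ij True
        by (subst advantaged_matrix_entry) (auto simp: payoff_matrix_entry[OF _ _ N_def refl])
    qed
    ultimately show ?thesis
      using True that[of ?t] by (simp add: min_absorb2 max_absorb1)
  next
    case False
    \<comment> \<open>Here \<open>c\<close> counts the chips of \<open>B\<close>. The reflection
      \<open>N - c\<close> and the complement to one each reverse the order, so payoffs of
      \<open>B\<close> grow with \<open>c\<close>; ties go to \<open>B\<close>, which puts the
      minimum into \<open>?f\<close>.\<close>
    let ?f = "\<lambda>c. 1 - min (?p (N - c)) (?q (N - c))" and ?g = "\<lambda>c. 1 - max (?p (N - c)) (?q (N - c))"
    let ?t = "\<lambda>k. (if k \<le> 0 then ?f (nat (int b + k)) else ?g (nat (int b + k))) + x * (real b + of_int k)"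
    have "toeplitz_game ?t (Suc a) (Suc b)"
    proof (rule toeplitz_game_of_chips[OF _ x0])
      fix c
      have N: "N - c = Suc (N - Suc c)" "N - Suc c < N" if "c < b + a"
        using that by (simp_all add: N_def)
      show "?f c \<le> ?f (Suc c) \<and> ?g c \<le> ?g (Suc c)" if "c < b + a"
        using mono[OF N(2)[OF that]] unfolding N(1)[OF that] by (auto simp: max_def min_def)
      show "?f c < ?f (Suc c) \<and> ?g c < ?g (Suc c)" if "x = 0" "c < b + a"
        using strict[OF that(1) N(2)[OF that(2)]] unfolding N(1)[OF that(2)] by (auto simp: max_def min_def)
      show "0 \<le> ?f c \<and> 0 \<le> ?g c"
        using bounds[of "N - c"] by (simp add: min_le_iff_disj)
    qed (use False in simp)
    moreover have "advantaged_matrix x a b (payoff_matrix G a b) $$ (i, j) = ?t (int i - int j)"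
      if ij: "i \<le> min a b" "j \<le> max a b" for i j
    proof -
      have c: "nat (int b + (int i - int j)) = b - j + i" "real b + of_int (int i - int j) = real (b - j + i)"
        and c': "N - (b - j + i) = a - i + j"
        using ij False by (auto simp: N_def)
      show ?thesis
        unfolding c c' using ij False
        by (subst advantaged_matrix_entry) (auto simp: payoff_matrix_entry[OF _ _ N_def refl])
    qed
    ultimately show ?thesis
      using False that[of ?t] by (simp add: min_absorb1 max_absorb2)
  qed
qed

end

text \<open>Invertibility comes for free from a nonnegative solution by
  \<open>solves_ones_nonsingular\<close>, and the inverse applied to the ones vector is then that
  solution.\<close>

lemma (in toeplitz_game) inverse_ones_nonneg_iff:
  assumes k: "1 \<le> k" "k \<le> m"
  shows "inverse_ones_nonneg (mat k k (\<lambda>(i, j). t (int i - int j))) \<longleftrightarrow> (\<exists>y. solves_ones t k y)"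
proof -
  let ?T = "mat k k (\<lambda>(i, j). t (int i - int j))" and ?one = "vec k (\<lambda>_. 1 :: real)"
  have solution: "toeplitz_row t k (\<lambda>j. (W *\<^sub>v ?one) $ j) (int i) = 1"
    if W: "W \<in> carrier_mat k k" "inverts_mat ?T W" and i: "i < k" for W i
  proof -
    have "?T *\<^sub>v (W *\<^sub>v ?one) = ?one"
      using W by (simp flip: assoc_mult_mat_vec[of _ k k _ k] add: inverts_mat_def)
    then show ?thesis
      using toeplitz_mult_vec[of "W *\<^sub>v ?one" k i t] W i by simp
  qed
  show ?thesis
  proof
    assume "inverse_ones_nonneg ?T"
    then obtain W where W: "W \<in> carrier_mat k k" "inverts_mat ?T W" "\<forall>i<k. 0 \<le> (W *\<^sub>v ?one) $ i"
      by (auto simp: inverse_ones_nonneg_def)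
    then have "solves_ones t k (\<lambda>j. (W *\<^sub>v ?one) $ j)"
      using solution[OF W(1,2)] unfolding solves_ones_def by blast
    then show "\<exists>y. solves_ones t k y" by blast
  next
    assume "\<exists>y. solves_ones t k y"
    then obtain y where y: "solves_ones t k y" by blast
    note nonsing = solves_ones_nonsingular[OF y k]
    obtain W where W: "W \<in> carrier_mat k k" "inverts_mat ?T W" "inverts_mat W ?T"
      using toeplitz_nonsingular_inverse[OF nonsing] by blast
    have rows: "toeplitz_row t k (\<lambda>j. (W *\<^sub>v ?one) $ j) (int i) = toeplitz_row t k y (int i)" if "i < k" for i
      using solution[OF W(1,2) that] y that by (simp add: solves_ones_def)
    have "(W *\<^sub>v ?one) $ j = y j" if "j < k" for j
      using toeplitz_nonsingularD[OF nonsing rows that] .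
    then have "\<forall>j<k. 0 \<le> (W *\<^sub>v ?one) $ j"
      using y by (simp add: solves_ones_def)
    then show "inverse_ones_nonneg ?T"
      using W by (auto simp: inverse_ones_nonneg_def)
  qed
qed

section \<open>The computed strategies\<close>

lemma sum_pad:
  assumes "length ys \<le> m"
  shows "(\<Sum>j<m. f j * pad m ys $ j) = (\<Sum>j<length ys. f j * ys ! j)"
proof -
  have "(\<Sum>j<length ys. f j * ys ! j) = (\<Sum>j<length ys. f j * pad m ys $ j)"
    using assms by (intro sum.cong) (auto simp: pad_def)
  also have "\<dots> = (\<Sum>j<m. f j * pad m ys $ j)"
    using assms by (intro sum.mono_neutral_left) (auto simp: pad_def)
  finally show ?thesis by simp
qed

lemma pad_strategies:
  assumes "length ys \<le> m" "\<And>j. j < length ys \<Longrightarrow> 0 \<le> ys ! j" "(\<Sum>j<length ys. ys ! j) = 1"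
  shows "pad m ys \<in> strategies m"
  using sum_pad[of ys m "\<lambda>_. 1"] assms by (simp add: strategies_def) (simp add: pad_def)

lemma sum_rev_nth: "(\<Sum>j<length ys. f j * rev ys ! j) = (\<Sum>j<length ys. f (length ys - 1 - j) * ys ! j)"
  by (rule sum.reindex_bij_witness[where i = "\<lambda>j. length ys - 1 - j" and j = "\<lambda>j. length ys - 1 - j"])
    (auto simp: rev_nth)

lemma result_row_payoff_t:
  "result (row_payoff_t M i j ss) = (\<Sum>l<length ss. M $$ (i, j + l) * ss ! l)"
  by (induction ss arbitrary: j) (simp_all add: sum.lessThan_Suc_shift del: sum.lessThan_Suc)

lemma result_payoff_t:
  "result (payoff_t M i ss ts) = (\<Sum>l<length ts. ts ! l * (\<Sum>j<length ss. M $$ (i + l, j) * ss ! j))"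
  by (induction ts arbitrary: i)
    (simp_all add: result_row_payoff_t sum.lessThan_Suc_shift del: sum.lessThan_Suc)

lemma diagonals_t_toeplitz:
  assumes dims: "dim_row M = Suc b" "dim_col M = Suc a"
    and entry: "\<And>i j. i \<le> min a b \<Longrightarrow> j \<le> max a b \<Longrightarrow>
      advantaged_matrix x a b M $$ (i, j) = t (int i - int j)"
  shows "result (diagonals_t x a b M (Suc (min a b))) =
    (map (\<lambda>i. t (int i)) [0..<Suc (min a b)], map (\<lambda>j. t (- int j)) [0..<Suc (min a b)])"
proof -
  have "result (adjusted_entry_t x a b M i j) = t (int i - int j)" if "i \<le> min a b" "j \<le> max a b" for i j
    using result_adjusted_entry_t[OF dims that] entry[OF that] by simp
  from this[of _ 0] this[of 0] show ?thesis
    unfolding result_diagonals_t by (auto simp del: upt_Suc min.bounded_iff)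
qed

text \<open>If \<open>B\<close> has the advantage, then the adjusted payoffs of the two players add up to
  \<open>1 + x * (a + b)\<close>.\<close>

lemma strategies_saddle_point:
  assumes dims: "dim_row M = Suc b" "dim_col M = Suc a"
    and game: "toeplitz_game t (Suc (min a b)) (Suc (max a b))"
    and entry: "\<And>i j. i \<le> min a b \<Longrightarrow> j \<le> max a b \<Longrightarrow>
      advantaged_matrix x a b M $$ (i, j) = t (int i - int j)"
  obtains v where "strategy_A x a b M \<in> strategies (Suc a)" "strategy_B x a b M \<in> strategies (Suc b)"
    "\<And>i. i \<le> b \<Longrightarrow> v \<le> (\<Sum>j<Suc a. adjusted_matrix x a M $$ (i, j) * strategy_A x a b M $ j)"
    "\<And>j. j \<le> a \<Longrightarrow> (\<Sum>i<Suc b. strategy_B x a b M $ i * adjusted_matrix x a M $$ (i, j)) \<le> v"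
    "computed_payoff x a b M = payoff_A M (strategy_A x a b M) (strategy_B x a b M)"
proof -
  define n where "n = Suc (min a b)"
  define vs where "vs = fst (result (diagonals_t x a b M n))"
  define hs where "hs = snd (result (diagonals_t x a b M n))"
  define adv where "adv = result (advantaged_strategy_t vs hs n)"
  define l where "l = length adv"
  have vs: "length vs = n" "\<And>i. i < n \<Longrightarrow> vs ! i = t (int i)"
    and hs: "length hs = n" "\<And>i. i < n \<Longrightarrow> hs ! i = t (- int i)"
    using diagonals_t_toeplitz[OF dims entry] by (simp_all add: vs_def hs_def n_def del: upt_Suc)
  interpret toeplitz_game t n "Suc (max a b)"
    using game by (simp add: n_def)
  obtain v where l: "1 \<le> l" "l \<le> n" and adv: "\<And>j. j < l \<Longrightarrow> 0 \<le> adv ! j" "(\<Sum>j<l. adv ! j) = 1"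
    and rows: "\<And>i. i < n \<Longrightarrow> v \<le> toeplitz_row t l (\<lambda>j. adv ! j) (int i)"
    and cols: "\<And>j. j < Suc (max a b) \<Longrightarrow> toeplitz_row t l (\<lambda>j. adv ! j) (int l - 1 - int j) \<le> v"
    using advantaged_strategy_t_correct[OF vs hs adv_def] unfolding l_def by metis
  have n: "Suc (if b \<le> a then b else a) = n" by (simp add: n_def min_def)
  have opp: "length (rev adv) = l" "\<And>j. j < l \<Longrightarrow> 0 \<le> rev adv ! j" "(\<Sum>j<l. rev adv ! j) = 1"
    using adv sum_rev_nth[of "\<lambda>_. 1" adv] by (auto simp: l_def rev_nth)
  define ss where "ss = (if b \<le> a then adv else rev adv)"
  define ts where "ts = (if b \<le> a then rev adv else adv)"
  have vh: "result (diagonals_t x a b M n) = (vs, hs)" by (simp add: vs_def hs_def)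
  have solve: "result (solve_turn_t x a b M) = (ss, ts, result (payoff_t M 0 ss ts))"
    unfolding solve_turn_t_def timed_simps n vh prod.case
    by (simp add: ss_def ts_def flip: adv_def)
  have A: "strategy_A x a b M = pad (Suc a) ss" and B: "strategy_B x a b M = pad (Suc b) ts"
    and V: "computed_payoff x a b M = result (payoff_t M 0 ss ts)"
    by (simp_all add: strategy_A_def strategy_B_def computed_payoff_def solve)
  have lens: "length ss = l" "length ts = l" "l \<le> Suc a" "l \<le> Suc b"
    using l by (simp_all add: ss_def ts_def l_def n_def)
  have sA: "pad (Suc a) ss \<in> strategies (Suc a)" and sB: "pad (Suc b) ts \<in> strategies (Suc b)"
    using adv opp lens by (auto intro!: pad_strategies simp: ss_def ts_def)
  have payoff: "result (payoff_t M 0 ss ts) = payoff_A M (pad (Suc a) ss) (pad (Suc b) ts)"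
  proof -
    have "payoff_A M (pad (Suc a) ss) (pad (Suc b) ts) =
        (\<Sum>i<Suc b. (\<Sum>j<Suc a. M $$ (i, j) * pad (Suc a) ss $ j) * pad (Suc b) ts $ i)"
      using dims sA sB by (simp add: payoff_A_sum strategies_carrier mult.commute del: sum.lessThan_Suc)
    also have "\<dots> = (\<Sum>i<length ts. (\<Sum>j<length ss. M $$ (i, j) * ss ! j) * ts ! i)"
      using lens by (simp add: sum_pad del: sum.lessThan_Suc)
    also have "\<dots> = result (payoff_t M 0 ss ts)"
      by (simp add: result_payoff_t mult.commute[of "ts ! _"])
    finally show ?thesis by simp
  qed
  have row: "(\<Sum>j<l. t (i - int j) * adv ! j) = toeplitz_row t l (\<lambda>j. adv ! j) i" for i
    by (simp add: toeplitz_row_def)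
  \<comment> \<open>Summing against the reversed strategy along a column is a row of the unreversed
    one; this matches \<open>cols\<close>.\<close>
  have rev_row: "(\<Sum>j<l. t (int j - i) * rev adv ! j) = toeplitz_row t l (\<lambda>j. adv ! j) (int l - 1 - i)" for i
    unfolding l_def sum_rev_nth toeplitz_row_def
    by (intro sum.cong) (auto simp: of_nat_diff algebra_simps)
  have A_row: "(\<Sum>j<Suc a. adjusted_matrix x a M $$ (i, j) * pad (Suc a) ss $ j) =
      (\<Sum>j<l. adjusted_matrix x a M $$ (i, j) * ss ! j)" for i
    using lens sum_pad[of ss "Suc a" "\<lambda>j. adjusted_matrix x a M $$ (i, j)"] by simp
  have B_col: "(\<Sum>i<Suc b. pad (Suc b) ts $ i * adjusted_matrix x a M $$ (i, j)) =
      (\<Sum>i<l. adjusted_matrix x a M $$ (i, j) * ts ! i)" for j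
    using lens sum_pad[of ts "Suc b" "\<lambda>i. adjusted_matrix x a M $$ (i, j)"] by (simp add: mult.commute)
  show ?thesis
  proof (cases "b \<le> a")
    case True
    have adj: "adjusted_matrix x a M $$ (i, j) = t (int i - int j)" if "i \<le> b" "j \<le> a" for i j
      using entry[of i j] that True by (simp add: advantaged_matrix_def)
    show ?thesis
    proof (rule that[of v]; unfold A B V)
      show "v \<le> (\<Sum>j<Suc a. adjusted_matrix x a M $$ (i, j) * pad (Suc a) ss $ j)" if "i \<le> b" for i
      proof -
        have "(\<Sum>j<l. adjusted_matrix x a M $$ (i, j) * ss ! j) = (\<Sum>j<l. t (int i - int j) * adv ! j)"
          using True lens that by (intro sum.cong) (auto simp: adj ss_def)
        then show ?thesis
          unfolding A_row using rows[of i] that True by (simp add: row n_def)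
      qed
      show "(\<Sum>i<Suc b. pad (Suc b) ts $ i * adjusted_matrix x a M $$ (i, j)) \<le> v" if "j \<le> a" for j
      proof -
        have "(\<Sum>i<l. adjusted_matrix x a M $$ (i, j) * ts ! i) = (\<Sum>i<l. t (int i - int j) * rev adv ! i)"
          using True lens that by (intro sum.cong) (auto simp: adj ts_def)
        then show ?thesis
          unfolding B_col using cols[of j] that True by (simp add: rev_row)
      qed
    qed (fact sA sB payoff)+
  next
    case False
    define K where "K = 1 + x * (real a + real b)"
    have adj: "adjusted_matrix x a M $$ (i, j) = K - t (int j - int i)" if "i \<le> b" "j \<le> a" for i j
    proof -
      have "t (int j - int i) = 1 - M $$ (i, j) + x * real (b - i + j)"
        using entry[of j i] advantaged_matrix_entry[OF dims, of j i x] that False by simp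
      moreover have "adjusted_matrix x a M $$ (i, j) = M $$ (i, j) + x * real (a - j + i)"
        using that dims by (simp add: adjusted_matrix_def)
      ultimately show ?thesis
        using that by (simp add: K_def of_nat_diff algebra_simps)
    qed
    have diff: "(\<Sum>j<l. (K - f j) * ys ! j) = K - (\<Sum>j<l. f j * ys ! j)"
      if "(\<Sum>j<l. ys ! j) = 1" for f and ys :: "real list"
      using that by (simp add: left_diff_distrib sum_subtractf flip: sum_distrib_left)
    show ?thesis
    \<comment> \<open>Now \<open>B\<close> plays the columns of the Toeplitz game and
      \<open>A\<close> the reversal, so \<open>cols\<close> becomes the guarantee of
      \<open>A\<close> and \<open>rows\<close> that of \<open>B\<close>.\<close>
    proof (rule that[of "K - v"]; unfold A B V)
      show "K - v \<le> (\<Sum>j<Suc a. adjusted_matrix x a M $$ (i, j) * pad (Suc a) ss $ j)" if "i \<le> b" for i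
      proof -
        have "(\<Sum>j<l. adjusted_matrix x a M $$ (i, j) * ss ! j) = (\<Sum>j<l. (K - t (int j - int i)) * rev adv ! j)"
          using False lens that by (intro sum.cong) (auto simp: adj ss_def)
        then show ?thesis
          unfolding A_row using cols[of i] that False by (simp add: diff opp rev_row)
      qed
      show "(\<Sum>i<Suc b. pad (Suc b) ts $ i * adjusted_matrix x a M $$ (i, j)) \<le> K - v" if "j \<le> a" for j
      proof -
        have "(\<Sum>i<l. adjusted_matrix x a M $$ (i, j) * ts ! i) = (\<Sum>i<l. (K - t (int j - int i)) * adv ! i)"
          using False lens that by (intro sum.cong) (auto simp: adj ts_def)
        then show ?thesis
          unfolding B_col using rows[of j] that False by (simp add: diff adv row n_def)
      qed
    qed (fact sA sB payoff)+
  qed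
qed

lemma length_test_correct:
  assumes dims: "dim_row M = Suc b" "dim_col M = Suc a"
    and game: "toeplitz_game t (Suc (min a b)) (Suc (max a b))"
    and entry: "\<And>i j. i \<le> min a b \<Longrightarrow> j \<le> max a b \<Longrightarrow>
      advantaged_matrix x a b M $$ (i, j) = t (int i - int j)"
    and k: "k \<in> {1..Suc (min a b)}"
  shows "length_test x a b M k \<longleftrightarrow>
    inverse_ones_nonneg (leading_submatrix k (advantaged_matrix x a b M))"
proof -
  define n where "n = Suc (min a b)"
  define vs where "vs = fst (result (diagonals_t x a b M n))"
  define hs where "hs = snd (result (diagonals_t x a b M n))"
  have vs: "length vs = n" "\<And>i. i < n \<Longrightarrow> vs ! i = t (int i)"
    and hs: "length hs = n" "\<And>i. i < n \<Longrightarrow> hs ! i = t (- int i)"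
    using diagonals_t_toeplitz[OF dims entry] by (simp_all add: vs_def hs_def n_def del: upt_Suc)
  interpret toeplitz_game t n "Suc (max a b)"
    using game by (simp add: n_def)
  have "advantaged_matrix x a b M $$ (i, j) = t (int i - int j)" if "i < k" "j < k" for i j
    by (rule entry) (use that k in auto)
  then have "leading_submatrix k (advantaged_matrix x a b M) = mat k k (\<lambda>(i, j). t (int i - int j))"
    unfolding leading_submatrix_def by (intro eq_matI) simp_all
  moreover have "length_test x a b M k \<longleftrightarrow> result (length_test_t vs hs k)"
    by (simp add: length_test_def vs_def hs_def n_def split: prod.split)
  ultimately show ?thesis
    using length_test_t_correct[OF vs hs, of k] inverse_ones_nonneg_iff[of k] k by (simp add: n_def)
qed

theorem mainTheorem3:
  "(\<exists>T :: nat \<Rightarrow> nat.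
      (\<lambda>n. real (T n)) \<in> O(\<lambda>n. ln (real n) * (real n)\<^sup>2) \<and>
      (\<forall>x a b M. cost (solve_turn_t x a b M) \<le> T (Suc (min a b)))) \<and>
   (\<forall>(V :: 'v set) red blue goal_A goal_B G a b M.
      bidding_game V red blue goal_A goal_B \<longrightarrow>
      G \<in> V - {goal_A, goal_B} \<longrightarrow>
      M = bidding_game.payoff_matrix red blue goal_A goal_B G a b \<longrightarrow>
      (\<forall>x. 0 < x \<or> (x = 0 \<and> bidding_game.precise red blue goal_A goal_B G a b) \<longrightarrow>
         (\<forall>k \<in> {1..Suc (min a b)}. length_test x a b M k \<longleftrightarrow>
            inverse_ones_nonneg (leading_submatrix k (advantaged_matrix x a b M))) \<and>
         optimal_A (adjusted_matrix x a M) (strategy_A x a b M) \<and>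
         optimal_B (adjusted_matrix x a M) (strategy_B x a b M) \<and>
         computed_payoff x a b M = payoff_A M (strategy_A x a b M) (strategy_B x a b M)) \<and>
      (bidding_game.precise red blue goal_A goal_B G a b \<longrightarrow>
         optimal_A M (strategy_A 0 a b M) \<and>
         optimal_B M (strategy_B 0 a b M) \<and>
         computed_payoff 0 a b M = bidding_game.v_A red blue goal_A goal_B G a b) \<and>
      (\<forall>\<epsilon>>0. \<exists>\<delta>>0. \<forall>x. 0 < x \<and> x < \<delta> \<longrightarrow>
         near_optimal_A \<epsilon> M (strategy_A x a b M) \<and>
         near_optimal_B \<epsilon> M (strategy_B x a b M) \<and>
         \<bar>computed_payoff x a b M - bidding_game.v_A red blue goal_A goal_B G a b\<bar> \<le> \<epsilon>))"
proof (rule conjI[OF solve_turn_time]; intro allI; rule impI; rule impI; rule impI)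
  fix V :: "'v set" and red blue goal_A goal_B G a b M
  assume "bidding_game V red blue goal_A goal_B"
    and G: "G \<in> V - {goal_A, goal_B}"
    and M: "M = bidding_game.payoff_matrix red blue goal_A goal_B G a b"
  then interpret bidding_game V red blue goal_A goal_B by simp
  have dims: "dim_row M = Suc b" "dim_col M = Suc a" by (simp_all add: M)
  \<comment> \<open>One statement with an explicit error serves both remaining claims: the error
    vanishes at \<open>x = 0\<close> and tends to zero with \<open>x\<close>. The factor 2 in the
    payoff bound adds the distances of payoff and value from \<open>v\<close>.\<close>
  have all: "(\<forall>k \<in> {1..Suc (min a b)}. length_test x a b M k \<longleftrightarrow>
          inverse_ones_nonneg (leading_submatrix k (advantaged_matrix x a b M)))
      \<and> optimal_A (adjusted_matrix x a M) (strategy_A x a b M)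
      \<and> optimal_B (adjusted_matrix x a M) (strategy_B x a b M)
      \<and> computed_payoff x a b M = payoff_A M (strategy_A x a b M) (strategy_B x a b M)
      \<and> near_optimal_A (2 * (x * (real a + real b))) M (strategy_A x a b M)
      \<and> near_optimal_B (2 * (x * (real a + real b))) M (strategy_B x a b M)
      \<and> \<bar>computed_payoff x a b M - v_A G a b\<bar> \<le> 2 * (x * (real a + real b))"
    if x: "0 < x \<or> (x = 0 \<and> precise G a b)" for x
  proof -
    define sA where "sA = strategy_A x a b M"
    define sB where "sB = strategy_B x a b M"
    let ?M' = "adjusted_matrix x a M" and ?e = "x * (real a + real b)"
    have x0: "0 \<le> x" using x by auto
    obtain t where t: "toeplitz_game t (Suc (min a b)) (Suc (max a b))"
      "\<And>i j. i \<le> min a b \<Longrightarrow> j \<le> max a b \<Longrightarrow> advantaged_matrix x a b M $$ (i, j) = t (int i - int j)"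
      using advantaged_matrix_toeplitz[OF G x] unfolding M by blast
    obtain v where v: "sA \<in> strategies (Suc a)" "sB \<in> strategies (Suc b)"
      "\<And>i. i \<le> b \<Longrightarrow> v \<le> (\<Sum>j<Suc a. ?M' $$ (i, j) * sA $ j)"
      "\<And>j. j \<le> a \<Longrightarrow> (\<Sum>i<Suc b. sB $ i * ?M' $$ (i, j)) \<le> v"
      and payoff: "computed_payoff x a b M = payoff_A M sA sB"
      using strategies_saddle_point[OF dims t] unfolding sA_def sB_def by blast
    \<comment> \<open>After the turn \<open>A\<close> holds between 0 and \<open>a + b\<close>
      chips.\<close>
    have close: "M $$ (i, j) \<le> ?M' $$ (i, j)" "?M' $$ (i, j) \<le> M $$ (i, j) + ?e" if "i \<le> b" "j \<le> a" for i j
      using that dims x0 by (auto simp: adjusted_matrix_def intro!: mult_left_mono)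
    have "near_optimal_A (2 * 0) ?M' sA" "near_optimal_B (2 * 0) ?M' sB"
      by (rule approximate_saddle_point[where v = v and s = sA and t = sB];
          use v dims in \<open>simp add: less_Suc_eq_le del: sum.lessThan_Suc\<close>)+
    then have optimal: "optimal_A ?M' sA" "optimal_B ?M' sB"
      by (simp_all add: near_optimal_zero)
    have rows: "v - ?e \<le> (\<Sum>j<dim_col M. M $$ (i, j) * sA $ j)" if "i < dim_row M" for i
    proof -
      have "v \<le> (\<Sum>j<Suc a. sA $ j * ?M' $$ (i, j))"
        using v(3)[of i] that dims by (simp add: mult.commute del: sum.lessThan_Suc)
      also have "\<dots> \<le> (\<Sum>j<Suc a. sA $ j * (M $$ (i, j) + ?e))"
        using v(1) close that dims by (intro sum_mono mult_left_mono) (auto simp: strategies_def)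
      also have "\<dots> = (\<Sum>j<Suc a. M $$ (i, j) * sA $ j) + ?e"
        using v(1) by (simp add: strategies_def distrib_left sum.distrib mult.commute
            flip: sum_distrib_right sum_distrib_left del: sum.lessThan_Suc)
      finally show ?thesis using dims by (simp del: sum.lessThan_Suc)
    qed
    have cols: "(\<Sum>i<dim_row M. sB $ i * M $$ (i, j)) \<le> v + ?e" if "j < dim_col M" for j
    proof -
      have "(\<Sum>i<Suc b. sB $ i * M $$ (i, j)) \<le> (\<Sum>i<Suc b. sB $ i * ?M' $$ (i, j))"
        using v(2) close that dims by (intro sum_mono mult_left_mono) (auto simp: strategies_def)
      also have "\<dots> \<le> v"
        using v(4)[of j] that dims by simp
      also have "\<dots> \<le> v + ?e" using x0 by simp
      finally show ?thesis using dims by (simp del: sum.lessThan_Suc)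
    qed
    have "near_optimal_A (2 * ?e) M sA \<and> near_optimal_B (2 * ?e) M sB
        \<and> \<bar>game_value M - v\<bar> \<le> ?e \<and> \<bar>payoff_A M sA sB - v\<bar> \<le> ?e"
      using approximate_saddle_point[OF _ _ _ _ rows cols] v(1,2) dims by simp
    moreover have "game_value M = v_A G a b"
      unfolding M by (rule game_value_payoff_matrix[OF G])
    ultimately have "near_optimal_A (2 * ?e) M sA" "near_optimal_B (2 * ?e) M sB"
      "\<bar>payoff_A M sA sB - v_A G a b\<bar> \<le> 2 * ?e"
      by (auto simp: abs_le_iff)
    then show ?thesis
      using optimal payoff length_test_correct[OF dims t] by (simp flip: sA_def sB_def)
  qed
  show "(\<forall>x. 0 < x \<or> (x = 0 \<and> precise G a b) \<longrightarrow>
         (\<forall>k \<in> {1..Suc (min a b)}. length_test x a b M k \<longleftrightarrow>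
            inverse_ones_nonneg (leading_submatrix k (advantaged_matrix x a b M))) \<and>
         optimal_A (adjusted_matrix x a M) (strategy_A x a b M) \<and>
         optimal_B (adjusted_matrix x a M) (strategy_B x a b M) \<and>
         computed_payoff x a b M = payoff_A M (strategy_A x a b M) (strategy_B x a b M)) \<and>
      (precise G a b \<longrightarrow>
         optimal_A M (strategy_A 0 a b M) \<and>
         optimal_B M (strategy_B 0 a b M) \<and>
         computed_payoff 0 a b M = v_A G a b) \<and>
      (\<forall>\<epsilon>>0. \<exists>\<delta>>0. \<forall>x. 0 < x \<and> x < \<delta> \<longrightarrow>
         near_optimal_A \<epsilon> M (strategy_A x a b M) \<and>
         near_optimal_B \<epsilon> M (strategy_B x a b M) \<and>
         \<bar>computed_payoff x a b M - v_A G a b\<bar> \<le> \<epsilon>)"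
  proof (intro conjI)
    show "\<forall>x. 0 < x \<or> (x = 0 \<and> precise G a b) \<longrightarrow>
         (\<forall>k \<in> {1..Suc (min a b)}. length_test x a b M k \<longleftrightarrow>
            inverse_ones_nonneg (leading_submatrix k (advantaged_matrix x a b M))) \<and>
         optimal_A (adjusted_matrix x a M) (strategy_A x a b M) \<and>
         optimal_B (adjusted_matrix x a M) (strategy_B x a b M) \<and>
         computed_payoff x a b M = payoff_A M (strategy_A x a b M) (strategy_B x a b M)"
      using all by blast
    show "precise G a b \<longrightarrow>
         optimal_A M (strategy_A 0 a b M) \<and> optimal_B M (strategy_B 0 a b M) \<and>
         computed_payoff 0 a b M = v_A G a b"
      using all[of 0] by (auto simp: near_optimal_zero)
    show "\<forall>\<epsilon>>0. \<exists>\<delta>>0. \<forall>x. 0 < x \<and> x < \<delta> \<longrightarrow>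
         near_optimal_A \<epsilon> M (strategy_A x a b M) \<and> near_optimal_B \<epsilon> M (strategy_B x a b M) \<and>
         \<bar>computed_payoff x a b M - v_A G a b\<bar> \<le> \<epsilon>"
    proof (intro allI impI)
      fix \<epsilon> :: real assume \<epsilon>: "0 < \<epsilon>"
      \<comment> \<open>The summand 1 keeps the denominator positive when nobody holds a
        chip.\<close>
      define \<delta> where "\<delta> = \<epsilon> / (2 * (real a + real b + 1))"
      have "near_optimal_A \<epsilon> M (strategy_A x a b M) \<and> near_optimal_B \<epsilon> M (strategy_B x a b M) \<and>
         \<bar>computed_payoff x a b M - v_A G a b\<bar> \<le> \<epsilon>" if x: "0 < x" "x < \<delta>" for x
      proof -
        have "2 * (x * (real a + real b)) \<le> 2 * (x * (real a + real b + 1))"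
          using x by simp
        also have "\<dots> \<le> 2 * (\<delta> * (real a + real b + 1))"
          using x by simp
        also have "\<dots> = \<epsilon>"
        proof -
          have "0 < real a + real b + 1" by simp
          then show ?thesis unfolding \<delta>_def by (simp add: divide_simps)
        qed
        finally have le: "2 * (x * (real a + real b)) \<le> \<epsilon>" .
        show ?thesis
          using all[of x] x le unfolding near_optimal_A_def near_optimal_B_def by fastforce
      qed
      moreover have "0 < \<delta>"
        using \<epsilon> by (simp add: \<delta>_def)
      ultimately show "\<exists>\<delta>>0. \<forall>x. 0 < x \<and> x < \<delta> \<longrightarrow>
         near_optimal_A \<epsilon> M (strategy_A x a b M) \<and> near_optimal_B \<epsilon> M (strategy_B x a b M) \<and>
         \<bar>computed_payoff x a b M - v_A G a b\<bar> \<le> \<epsilon>"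
        by blast
    qed
  qed
qed

end
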